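(* (i) All selfdecomposable distributions on $\mathbb{R}$ are perpetuities, i.e., a real random variable $Z$ with such a distribution satisfies $$Z\stackrel{d}{=}AZ+B$$ for some random vector $(A,B)$ in $\mathbb{R}^2$ independent of $Z$, with non-trivial $0\le A\le 1$ a.s. (ii) All selfdecomposable distributions on $\mathbb{R}$ whose background driving Lévy process $Y$ has non-zero purely discontinuous part have convolution factors that satisfy the equation $$Z\stackrel{d}{=}A(Z+C),$$ where $A,C,Z$ are independent real random variables and $Z$ has the convolution factor as its distribution.
   Context: All random variables are real valued; $\stackrel{d}{=}$ denotes equality in distribution. A probability measure $\nu$ is a convolution factor of $\mu$ if $\mu=\nu*\rho$ for some probability measure $\rho$, where $*$ is convolution. A random variable $X$ (or its distribution) is selfdecomposable if for each $t>0$ there exists a random variable $X_t$ independent of $X$ such that $X\stackrel{d}{=}X_t+e^{-t}X$. Perpetuities: for i.i.d. random vectors $(A,B),(A_1,B_1),(A_2,B_2),\ldots$ in $\mathbb{R}^2$ consider $Z_{n+1}=A_nZ_n+B_n$. Started at $0$ and assuming convergence of $(Z_n)$ to $Z$, one has $Z\stackrel{d}{=}\sum_{k=1}^{\infty}B_k\prod_{l=1}^{k-1}A_l$; distributions of such $Z$ are called perpetuities, and they are solutions of $Z\stackrel{d}{=}AZ+B$, i.e. distributional fixed points of the random affine mapping $x\mapsto Ax+B$. A Lévy process is a process $Y(t)$, $t\ge 0$, with $Y(0)=0$ a.s., stationary and independent increments, and càdlàg paths a.s. For a Lévy process $Y$ with $\mathbb{E}[\log(1+|Y(1)|)]<\infty$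 put $$\int_{(0,t]}e^{-s}\,dY(s):=e^{-t}Y(t)+\int_{(0,t]}Y(s-)e^{-s}\,ds,$$ and let $\int_{(0,\infty)}e^{-s}\,dY(s)$ be its limit as $t\to\infty$, which exists. It is known that $X$ is selfdecomposable if and only if $X\stackrel{d}{=}\int_{(0,\infty)}e^{-s}\,dY(s)$ for some Lévy process $Y$, unique in distribution, with $\mathbb{E}[\log(1+|Y(1)|)]<\infty$; this $Y$ is called the background driving Lévy process (BDLP) of $X$. Any Lévy process $Y$ can be written as a sum $Y=Y^c+Y^d$ of two independent Lévy processes, where $Y^c$ is purely continuous (Gaussian) and $Y^d$ is purely discontinuous (càdlàg); $Y^d$ is the purely discontinuous part of $Y$. *)

theory Defs
  imports "HOL-Probability.Probability"
begin

text \<open>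
  Laws on the real line are Borel probability measures, i.e. instances of the library locale
  \<^locale>\<open>real_distribution\<close>; \<open>\<mu> \<star> \<rho>\<close> is the library convolution.
\<close>

definition convolution_factor :: "real measure \<Rightarrow> real measure \<Rightarrow> bool" where
  "convolution_factor \<nu> \<mu> \<longleftrightarrow>
     real_distribution \<nu> \<and> (\<exists>\<rho>. real_distribution \<rho> \<and> \<mu> = (\<nu> \<star> \<rho>))"

text \<open>
  Here \<open>\<rho>\<close> is the law of \<open>X\<^sub>t\<close>: since \<open>X\<^sub>t\<close> is independent of \<open>X\<close>, the law of
  \<open>X\<^sub>t + exp (- t) * X\<close> is the convolution below.
\<close>

definition selfdecomposable :: "real measure \<Rightarrow> bool" where
  "selfdecomposable \<mu> \<longleftrightarrow>
     real_distribution \<mu> \<and>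
     (\<forall>t>0. \<exists>\<rho>. real_distribution \<rho> \<and> \<mu> = (\<rho> \<star> distr \<mu> borel (\<lambda>x. exp (- t) * x)))"


text \<open>
  The library constant \<open>indep_var\<close> forces both variables to have values in the same type; this is
  the same notion for values in arbitrary types.
\<close>

definition independent_rvs ::
  "'a measure \<Rightarrow> 'b measure \<Rightarrow> ('a \<Rightarrow> 'b) \<Rightarrow> 'c measure \<Rightarrow> ('a \<Rightarrow> 'c) \<Rightarrow> bool" where
  "independent_rvs M N1 X N2 Y \<longleftrightarrow>
     X \<in> measurable M N1 \<and> Y \<in> measurable M N2 \<and>
     prob_space.indep_set M
       {X -` S \<inter> space M |S. S \<in> sets N1} {Y -` S \<inter> space M |S. S \<in> sets N2}"


subsection \<open>Perpetuities\<close>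

primrec affine_iteration ::
  "(nat \<Rightarrow> 'a \<Rightarrow> real) \<Rightarrow> (nat \<Rightarrow> 'a \<Rightarrow> real) \<Rightarrow> nat \<Rightarrow> 'a \<Rightarrow> real" where
  "affine_iteration A B 0 \<omega> = 0"
| "affine_iteration A B (Suc n) \<omega> = A n \<omega> * affine_iteration A B n \<omega> + B n \<omega>"

text \<open>
  \<open>perpetuity \<kappa> \<mu>\<close>: for i.i.d. pairs \<open>(A\<^sub>n, B\<^sub>n)\<close> with common law \<open>\<kappa>\<close>, the
  iteration started at \<open>0\<close> converges to \<open>\<mu>\<close>. The convergence is in distribution; the iterates
  themselves do not converge pathwise in general. The law of the iterates depends on \<open>\<kappa>\<close>
  only, so nothing is lost by fixing the type of the sample space.
\<close>

definition perpetuity :: "(real \<times> real) measure \<Rightarrow> real measure \<Rightarrow> bool" where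
  "perpetuity \<kappa> \<mu> \<longleftrightarrow>
     (\<exists>(M :: (nat \<Rightarrow> real \<times> real) measure) A B.
        prob_space M \<and>
        prob_space.indep_vars M (\<lambda>_. borel) (\<lambda>n \<omega>. (A n \<omega>, B n \<omega>)) (UNIV :: nat set) \<and>
        (\<forall>n. distr M borel (\<lambda>\<omega>. (A n \<omega>, B n \<omega>)) = \<kappa>) \<and>
        weak_conv_m (\<lambda>n. distr M borel (affine_iteration A B n)) \<mu>)"

text \<open>
  A random multiplier is trivial if it is a.s. constant or if it only takes the values \<open>0\<close> and
  \<open>1\<close>. The second case has to be excluded as well: if \<open>Z'\<close> is a copy of \<open>Z\<close> and \<open>A\<close>, \<open>Z'\<close>,
  \<open>Z\<close> are independent with \<open>A \<in> {0, 1}\<close>, then \<open>A * Z + (1 - A) * Z'\<close> has the law of \<open>Z\<close>,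
  whatever that law is.
\<close>

definition nontrivial_multiplier :: "'a measure \<Rightarrow> ('a \<Rightarrow> real) \<Rightarrow> bool" where
  "nontrivial_multiplier M A \<longleftrightarrow>
     \<not> (\<exists>c. AE \<omega> in M. A \<omega> = c) \<and> \<not> (AE \<omega> in M. A \<omega> \<in> {0, 1})"


subsection \<open>Levy processes\<close>

definition cadlag :: "(real \<Rightarrow> real) \<Rightarrow> bool" where
  "cadlag f \<longleftrightarrow>
     (\<forall>t\<ge>0. (f \<longlongrightarrow> f t) (at_right t)) \<and> (\<forall>t>0. \<exists>l. (f \<longlongrightarrow> l) (at_left t))"

text \<open>Processes are indexed by the whole real line, but only times \<open>t \<ge> 0\<close> are ever used.\<close>

definition levy_process :: "'a measure \<Rightarrow> (real \<Rightarrow> 'a \<Rightarrow> real) \<Rightarrow> bool" where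
  "levy_process M Y \<longleftrightarrow>
     prob_space M \<and>
     (\<forall>t\<ge>0. Y t \<in> borel_measurable M) \<and>
     (AE \<omega> in M. Y 0 \<omega> = 0) \<and>
     (\<forall>s\<ge>0. \<forall>h\<ge>0. distr M borel (\<lambda>\<omega>. Y (s + h) \<omega> - Y s \<omega>) =
                   distr M borel (\<lambda>\<omega>. Y h \<omega> - Y 0 \<omega>)) \<and>
     (\<forall>(n::nat) t. 0 \<le> t 0 \<and> (\<forall>i<n. t i \<le> t (Suc i)) \<longrightarrow>
        prob_space.indep_vars M (\<lambda>_. borel) (\<lambda>i \<omega>. Y (t (Suc i)) \<omega> - Y (t i) \<omega>) {..<n}) \<and>
     (AE \<omega> in M. cadlag (\<lambda>t. Y t \<omega>))"

text \<open>The integral over \<open>(0, t]\<close>, defined pathwise by formal integration by parts.\<close>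

definition exp_integral :: "(real \<Rightarrow> 'a \<Rightarrow> real) \<Rightarrow> real \<Rightarrow> 'a \<Rightarrow> real" where
  "exp_integral Y t \<omega> =
     exp (- t) * Y t \<omega> +
     (LINT s:{0<..t}|lborel. Lim (at_left s) (\<lambda>r. Y r \<omega>) * exp (- s))"

definition background_driving_levy_process ::
  "'a measure \<Rightarrow> (real \<Rightarrow> 'a \<Rightarrow> real) \<Rightarrow> real measure \<Rightarrow> bool" where
  "background_driving_levy_process M Y \<mu> \<longleftrightarrow>
     levy_process M Y \<and>
     integrable M (\<lambda>\<omega>. ln (1 + \<bar>Y 1 \<omega>\<bar>)) \<and>
     (\<exists>I \<in> borel_measurable M.
        (AE \<omega> in M. ((\<lambda>t. exp_integral Y t \<omega>) \<longlongrightarrow> I \<omega>) at_top) \<and>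
        distr M borel I = \<mu>)"

definition levy_measure :: "real measure \<Rightarrow> bool" where
  "levy_measure L \<longleftrightarrow>
     sets L = sets borel \<and> emeasure L {0} = 0 \<and>
     (\<integral>\<^sup>+ x. ennreal (min 1 (x\<^sup>2)) \<partial>L) < \<infinity>"

text \<open>
  Purely discontinuous Levy processes are those with Levy--Khintchine triplet \<open>(0, 0, L)\<close>: no
  Gaussian component, and no drift relative to the truncation to \<open>[-1, 1]\<close>, so that \<open>L\<close> is the
  jump intensity and such a process is zero iff it has no jumps. In the decomposition below,
  the drift therefore belongs to the continuous part, which is Gaussian with drift.
\<close>

definition purely_discontinuous :: "'a measure \<Rightarrow> (real \<Rightarrow> 'a \<Rightarrow> real) \<Rightarrow> bool" where
  "purely_discontinuous M Y \<longleftrightarrow>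
     levy_process M Y \<and>
     (\<exists>L. levy_measure L \<and>
        (\<forall>t\<ge>0. \<forall>u. char (distr M borel (Y t)) u =
           exp (of_real t *
             (CLINT x|L. iexp (u * x) - 1 - \<i> * of_real (u * x * indicator {-1..1} x)))))"

definition purely_continuous :: "'a measure \<Rightarrow> (real \<Rightarrow> 'a \<Rightarrow> real) \<Rightarrow> bool" where
  "purely_continuous M Y \<longleftrightarrow>
     levy_process M Y \<and> (AE \<omega> in M. continuous_on {0..} (\<lambda>t. Y t \<omega>))"

definition independent_processes ::
  "'a measure \<Rightarrow> (real \<Rightarrow> 'a \<Rightarrow> real) \<Rightarrow> (real \<Rightarrow> 'a \<Rightarrow> real) \<Rightarrow> bool" where
  "independent_processes M X Y \<longleftrightarrow>
     prob_space.indep_var M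
       (PiM {0..} (\<lambda>_. borel)) (\<lambda>\<omega>. \<lambda>t\<in>{0..}. X t \<omega>)
       (PiM {0..} (\<lambda>_. borel)) (\<lambda>\<omega>. \<lambda>t\<in>{0..}. Y t \<omega>)"

definition levy_decomposition ::
  "'a measure \<Rightarrow> (real \<Rightarrow> 'a \<Rightarrow> real) \<Rightarrow> (real \<Rightarrow> 'a \<Rightarrow> real) \<Rightarrow> (real \<Rightarrow> 'a \<Rightarrow> real) \<Rightarrow> bool"
where
  "levy_decomposition M Y Yc Yd \<longleftrightarrow>
     purely_continuous M Yc \<and> purely_discontinuous M Yd \<and>
     independent_processes M Yc Yd \<and>
     (AE \<omega> in M. \<forall>t\<ge>0. Y t \<omega> = Yc t \<omega> + Yd t \<omega>)"

definition nonzero_process :: "'a measure \<Rightarrow> (real \<Rightarrow> 'a \<Rightarrow> real) \<Rightarrow> bool" where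
  "nonzero_process M Y \<longleftrightarrow> (\<exists>t\<ge>0. \<not> (AE \<omega> in M. Y t \<omega> = 0))"

end

theory Submission
  imports Defs
begin

text \<open>
  (i) If \<open>A\<close> takes the values \<open>exp (- 1)\<close> and \<open>exp (- 2)\<close> with probability \<open>1 / 2\<close> each and,
  given \<open>A = exp (- t)\<close>, the variable \<open>B\<close> has the law of \<open>X\<^sub>t\<close>, then \<open>A * Z + B\<close> has the law of
  \<open>Z\<close>; the iteration from \<open>0\<close> converges because \<open>A\<close> is bounded away from \<open>1\<close>.

  (ii) Let \<open>K\<close> be the Levy measure of \<open>Y\<^sup>d\<close> restricted to a compact set of positive mass that
  avoids \<open>0\<close>, and let \<open>k u = \<integral>(iexp (u * x) - 1) dK(x)\<close>. The factor is the law \<open>\<nu>\<close> of the integral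
  \<open>\<integral>exp (- s) dN(s)\<close> over \<open>s > 0\<close>, \<open>N\<close> being the compound Poisson process with jump intensity \<open>K\<close>. Its first
  jump time \<open>T\<close> is exponential with the rate \<open>K(UNIV)\<close>; conditioning on it gives \<open>Z = A * (Z + C)\<close> in law
  with \<open>A = exp (- T)\<close>. Instead of decomposing paths, everything is read off characteristic
  functions: \<open>\<nu>\<close> has characteristic function \<open>exp (G u)\<close> with \<open>G u = \<integral>k (u * exp (- s)) ds\<close> over
  \<open>s > 0\<close>, and \<open>char \<mu> u * exp (- G u)\<close> is a limit of products of characteristic functions, coming
  from the Riemann sums of the integral that represents \<open>\<mu>\<close>.
\<close>

section \<open>Characteristic functions\<close>

text \<open>Two features shape the argument. First, a quotient of characteristic functions is in
  general not a characteristic function, so \<open>char \<mu> u * exp (- G u)\<close> has to be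
  built from genuine ones: on a finite grid the factor \<open>exp (h * k)\<close> can be removed
  from every increment of \<open>Y\<close> separately, because there the splitting of the Levy
  measure shows what remains. Passing to the limit needs a continuity theorem whose limit function
  is not known beforehand to belong to a law. For this reason \<open>characteristic_function\<close>
  is a predicate on functions, closed under products, scaling, mixtures and pointwise limits that
  are continuous at 0; laws are identified only at the end, by uniqueness. Second, the compact set
  that avoids 0 serves two purposes: away from 0 the Levy measure is finite, so that there is a
  first jump; boundedness makes \<open>k v / v\<close> continuous at 0, and this makes the integral
  of \<open>k (u * exp (- s))\<close> over all s > 0 converge. In (i), a single time t would make
  \<open>A\<close> constant; two distinct times are the simplest choice with a non-trivial
  multiplier.\<close>

definition characteristic_function :: "(real \<Rightarrow> complex) \<Rightarrow> bool" where
  "characteristic_function \<phi> \<longleftrightarrow> (\<exists>M. real_distribution M \<and> \<phi> = char M)"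

lemma characteristic_function_char [intro]:
  "real_distribution M \<Longrightarrow> characteristic_function (char M)"
  unfolding characteristic_function_def by blast

lemma (in prob_space) characteristic_function_distr:
  assumes "X \<in> borel_measurable M"
  shows "characteristic_function (\<lambda>u. CLINT \<omega>|M. iexp (u * X \<omega>))"
proof -
  have "char (distr M borel X) = (\<lambda>u. CLINT \<omega>|M. iexp (u * X \<omega>))"
    using assms by (auto simp: char_def integral_distr)
  then show ?thesis
    using assms by (metis characteristic_function_def real_distribution_distr)
qed

lemma characteristic_function_props:
  assumes "characteristic_function \<phi>"
  shows characteristic_function_norm: "norm (\<phi> u) \<le> 1"
    and characteristic_function_isCont: "isCont \<phi> u"
    and characteristic_function_measurable: "\<phi> \<in> borel_measurable borel"
  using assms real_distribution.cmod_char_le_1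
    real_distribution.isCont_char real_distribution.char_measurable
  unfolding characteristic_function_def by auto

text \<open>The convolution is the law of the sum of the coordinates on the product space, so Fubini
  splits the exponential. Read backwards together with uniqueness, the product formula is what
  finally yields \<mu> as a convolution.\<close>

lemma real_distribution_convolution:
  assumes "real_distribution M" "real_distribution N"
  shows "real_distribution (M \<star> N)"
    and "char (M \<star> N) u = char M u * char N u"
proof -
  interpret M: real_distribution M by fact
  interpret N: real_distribution N by fact
  interpret pair_prob_space M N ..
  show "real_distribution (M \<star> N)"
    unfolding convolution_def by (rule real_distribution_distr) measurable
  have "char (M \<star> N) u = (CLINT z|M \<Otimes>\<^sub>M N. iexp (u * (fst z + snd z)))"
    unfolding convolution_def char_def by (simp add: integral_distr split_beta')
  also have "\<dots> = (CLINT x|M. CLINT y|N. iexp (u * (x + y)))"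
    by (subst integral_fst'[symmetric]) (auto intro!: integrable_const_bound[where B = 1])
  also have "\<dots> = (CLINT x|M. iexp (u * x) * (CLINT y|N. iexp (u * y)))"
    by (simp add: distrib_left exp_add)
  also have "\<dots> = char M u * char N u"
    unfolding char_def by simp
  finally show "char (M \<star> N) u = char M u * char N u" .
qed

lemma characteristic_function_mult:
  assumes "characteristic_function \<phi>" "characteristic_function \<psi>"
  shows "characteristic_function (\<lambda>u. \<phi> u * \<psi> u)"
proof -
  from assms obtain M N where "real_distribution M" "\<phi> = char M" "real_distribution N" "\<psi> = char N"
    unfolding characteristic_function_def by auto
  then have "real_distribution (M \<star> N)" "(\<lambda>u. \<phi> u * \<psi> u) = char (M \<star> N)"
    by (auto simp: real_distribution_convolution)
  then show ?thesis
    unfolding characteristic_function_def by blast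
qed

lemma characteristic_function_iexp: "characteristic_function (\<lambda>u. iexp (u * c))"
proof -
  interpret prob_space "return borel c" by (rule prob_space_return) simp
  have "characteristic_function (\<lambda>u. CLINT x|return borel c. iexp (u * x))"
    by (rule characteristic_function_distr) simp
  then show ?thesis
    by (simp add: integral_return)
qed

lemma characteristic_function_1: "characteristic_function (\<lambda>u. 1)"
  using characteristic_function_iexp[of 0] by simp

lemma characteristic_function_prod:
  assumes "\<And>j. j \<in> I \<Longrightarrow> characteristic_function (\<phi> j)"
  shows "characteristic_function (\<lambda>u. \<Prod>j\<in>I. \<phi> j u)"
  using assms
  by (induction I rule: infinite_finite_induct)
     (auto intro: characteristic_function_1 characteristic_function_mult)

lemma characteristic_function_scale:
  assumes "characteristic_function \<phi>"
  shows "characteristic_function (\<lambda>u. \<phi> (u * c))"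
proof -
  obtain M where M: "real_distribution M" "\<phi> = char M"
    using assms unfolding characteristic_function_def by auto
  interpret real_distribution M by fact
  have "characteristic_function (\<lambda>u. CLINT x|M. iexp (u * (c * x)))"
    by (rule characteristic_function_distr) simp
  then show ?thesis
    by (simp add: M char_def mult.assoc)
qed

subsection \<open>Mixtures\<close>

text \<open>Both draws are always made and the coin only selects between them. One product space
  thus serves for mixtures of laws and for pairs whose second component depends on the coin.\<close>

definition bernoulli_mix :: "real \<Rightarrow> real measure \<Rightarrow> real measure \<Rightarrow> (bool \<times> real \<times> real) measure" where
  "bernoulli_mix p M N = measure_pmf (bernoulli_pmf p) \<Otimes>\<^sub>M (M \<Otimes>\<^sub>M N)"

lemma prob_space_bernoulli_mix:
  assumes "real_distribution M" "real_distribution N"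
  shows "prob_space (bernoulli_mix p M N)"
proof -
  interpret M: real_distribution M by fact
  interpret N: real_distribution N by fact
  interpret MN: pair_prob_space M N ..
  interpret pair_prob_space "measure_pmf (bernoulli_pmf p)" "M \<Otimes>\<^sub>M N" ..
  show ?thesis unfolding bernoulli_mix_def by unfold_locales
qed

lemma sets_bernoulli_mix [measurable_cong]:
  assumes "real_distribution M" "real_distribution N"
  shows "sets (bernoulli_mix p M N) = sets (count_space UNIV \<Otimes>\<^sub>M (borel \<Otimes>\<^sub>M borel))"
  using assms unfolding bernoulli_mix_def
  by (intro sets_pair_measure_cong) (auto simp: real_distribution.events_eq_borel)

lemma integral_bernoulli_mix:
  fixes f g :: "real \<Rightarrow> complex"
  assumes MN: "real_distribution M" "real_distribution N" and p: "0 \<le> p" "p \<le> 1"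
    and [measurable]: "f \<in> borel_measurable borel" "g \<in> borel_measurable borel"
    and bound: "\<And>x. norm (f x) \<le> B" "\<And>x. norm (g x) \<le> B"
  shows "(CLINT z|bernoulli_mix p M N. if fst z then f (fst (snd z)) else g (snd (snd z))) =
      p * (CLINT x|M. f x) + of_real (1 - p) * (CLINT x|N. g x)"
proof -
  interpret M: real_distribution M by fact
  interpret N: real_distribution N by fact
  interpret MN: pair_prob_space M N ..
  interpret X: pair_prob_space "measure_pmf (bernoulli_pmf p)" "M \<Otimes>\<^sub>M N" ..
  have f: "(CLINT z|M \<Otimes>\<^sub>M N. f (fst z)) = (CLINT x|M. f x)"
    by (subst MN.integral_fst'[symmetric])
       (auto intro!: MN.integrable_const_bound[where B = B] bound simp: N.prob_space[unfolded N.space_eq_univ])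
  have g: "(CLINT z|M \<Otimes>\<^sub>M N. g (snd z)) = (CLINT x|N. g x)"
    by (subst MN.integral_fst'[symmetric])
       (auto intro!: MN.integrable_const_bound[where B = B] bound simp: M.prob_space[unfolded M.space_eq_univ])
  have "(CLINT z|bernoulli_mix p M N. if fst z then f (fst (snd z)) else g (snd (snd z))) =
     (CLINT b|measure_pmf (bernoulli_pmf p). CLINT z|M \<Otimes>\<^sub>M N. if b then f (fst z) else g (snd z))"
    unfolding bernoulli_mix_def
    by (subst X.integral_fst'[symmetric]) (auto intro!: X.integrable_const_bound[where B = B] bound cong: if_cong)
  also have "\<dots> = (CLINT b|measure_pmf (bernoulli_pmf p). if b then (CLINT x|M. f x) else (CLINT x|N. g x))"
    by (rule Bochner_Integration.integral_cong) (auto simp: f g)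
  also have "\<dots> = p * (CLINT x|M. f x) + of_real (1 - p) * (CLINT x|N. g x)"
    using p by (subst integral_measure_pmf[where A = UNIV]) (auto simp: UNIV_bool scaleR_conv_of_real)
  finally show ?thesis .
qed

lemma characteristic_function_mix:
  fixes p :: real and \<phi> \<psi> :: "real \<Rightarrow> complex"
  assumes "characteristic_function \<phi>" "characteristic_function \<psi>" and p: "0 \<le> p" "p \<le> 1"
  shows "characteristic_function (\<lambda>u. of_real p * \<phi> u + of_real (1 - p) * \<psi> u)"
proof -
  obtain M N where MN: "real_distribution M" "\<phi> = char M" "real_distribution N" "\<psi> = char N"
    using assms unfolding characteristic_function_def by auto
  note [measurable_cong] = sets_bernoulli_mix[OF MN(1,3)]
  interpret prob_space "bernoulli_mix p M N" by (rule prob_space_bernoulli_mix) fact+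
  have "characteristic_function (\<lambda>u. CLINT z|bernoulli_mix p M N.
      iexp (u * (if fst z then fst (snd z) else snd (snd z))))"
    by (rule characteristic_function_distr) measurable
  also have "(\<lambda>u. CLINT z|bernoulli_mix p M N.
      iexp (u * (if fst z then fst (snd z) else snd (snd z)))) = (\<lambda>u. of_real p * \<phi> u + of_real (1 - p) * \<psi> u)"
  proof
    fix u
    have "(CLINT z|bernoulli_mix p M N. iexp (u * (if fst z then fst (snd z) else snd (snd z)))) =
      (CLINT z|bernoulli_mix p M N. if fst z then iexp (u * fst (snd z)) else iexp (u * snd (snd z)))"
      by (rule Bochner_Integration.integral_cong) auto
    also have "\<dots> = p * (CLINT x|M. iexp (u * x)) + of_real (1 - p) * (CLINT x|N. iexp (u * x))"
      by (rule integral_bernoulli_mix[where B = 1 and f = "\<lambda>x. iexp (u * x)" and g = "\<lambda>x. iexp (u * x)"])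
        (use MN p in auto)
    finally show "(CLINT z|bernoulli_mix p M N.
        iexp (u * (if fst z then fst (snd z) else snd (snd z)))) = of_real p * \<phi> u + of_real (1 - p) * \<psi> u"
      by (simp add: MN char_def)
  qed
  finally show ?thesis .
qed

subsection \<open>Limits\<close>

text \<open>
  Averaging over Gaussian frequencies turns closeness of the characteristic function to \<open>1\<close>
  near the origin into a bound on the tails.
\<close>

lemma gaussian_average_char:
  assumes "real_distribution M"
  shows "(CLINT s|std_normal_distribution. char M (u * s)) = (LINT x|M. exp (- (u * x)\<^sup>2 / 2))"
proof -
  interpret M: real_distribution M by fact
  interpret N: real_distribution std_normal_distribution by (rule real_dist_normal_dist)
  interpret pair_prob_space std_normal_distribution M ..
  have "(CLINT s|std_normal_distribution. char M (u * s)) =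
      (CLINT s|std_normal_distribution. CLINT x|M. iexp (u * s * x))"
    unfolding char_def ..
  also have "\<dots> = (CLINT x|M. CLINT s|std_normal_distribution. iexp (u * s * x))"
    by (rule Fubini_integral[symmetric])
       (auto simp: split_beta' intro!: integrable_const_bound[where B = 1])
  also have "\<dots> = (CLINT x|M. char std_normal_distribution (u * x))"
    unfolding char_def by (simp add: ac_simps)
  also have "\<dots> = (LINT x|M. exp (- (u * x)\<^sup>2 / 2))"
    unfolding char_std_normal_distribution by (simp flip: integral_complex_of_real)
  finally show ?thesis .
qed

text \<open>A Markov inequality: 1 - exp (- (u x)^2 / 2) is non-negative everywhere and at least 1 -
  exp (- 1 / 2) once |u x| is at least 1, and its integral is 1 minus the Gaussian average.\<close>

lemma tail_bound_gaussian:
  assumes "real_distribution M" "0 < u"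
  shows "(1 - exp (- 1 / 2)) * measure M {x. 1 / u \<le> \<bar>x\<bar>} \<le>
      norm (1 - (CLINT s|std_normal_distribution. char M (u * s)))"
proof -
  interpret M: real_distribution M by fact
  have int: "integrable M (\<lambda>x. exp (- (u * x)\<^sup>2 / 2))"
    by (rule M.integrable_const_bound[where B = 1]) auto
  have [measurable]: "{x. 1 / u \<le> \<bar>x\<bar>} \<in> sets M"
    by simp
  have le: "(1 - exp (- 1 / 2)) * indicator {x. 1 / u \<le> \<bar>x\<bar>} x \<le> 1 - exp (- (u * x)\<^sup>2 / 2)" for x :: real
  proof (cases "1 / u \<le> \<bar>x\<bar>")
    case True
    then have "1 \<le> \<bar>u * x\<bar>"
      using \<open>0 < u\<close> by (simp add: abs_mult field_simps)
    then have "1 \<le> (u * x)\<^sup>2"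
      using power_mono[of 1 "\<bar>u * x\<bar>" 2] by simp
    then show ?thesis using True by simp
  qed simp
  have "(1 - exp (- 1 / 2)) * measure M {x. 1 / u \<le> \<bar>x\<bar>} =
      (LINT x|M. (1 - exp (- 1 / 2)) * indicator {x. 1 / u \<le> \<bar>x\<bar>} x)"
    by simp
  also have "\<dots> \<le> (LINT x|M. 1 - exp (- (u * x)\<^sup>2 / 2))"
    by (intro integral_mono le Bochner_Integration.integrable_diff int) (auto simp: M.emeasure_eq_measure)
  also have "\<dots> = 1 - (LINT x|M. exp (- (u * x)\<^sup>2 / 2))"
    using int M.prob_space by (simp del: M.space_eq_univ)
  also have "\<dots> \<le> norm (complex_of_real (1 - (LINT x|M. exp (- (u * x)\<^sup>2 / 2))))"
    by (simp only: norm_of_real abs_ge_self)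
  finally show ?thesis
    by (simp add: gaussian_average_char[OF assms(1)])
qed

text \<open>Dominated convergence, as the frequencies shrink to 0. No law is attached to
  \<open>\<psi>\<close>, since the lemma is applied both to characteristic functions and to a
  pointwise limit not yet known to be one.\<close>

lemma gaussian_average_tendsto_1:
  assumes "\<psi> \<in> borel_measurable borel" "\<And>u. norm (\<psi> u) \<le> 1" "isCont \<psi> 0" "\<psi> 0 = (1::complex)"
  shows "(\<lambda>k. CLINT s|std_normal_distribution. \<psi> (1 / real (Suc k) * s)) \<longlonglongrightarrow> 1"
proof -
  interpret N: real_distribution std_normal_distribution by (rule real_dist_normal_dist)
  note [measurable] = assms(1)
  have "(\<lambda>k. CLINT s|std_normal_distribution. \<psi> (1 / real (Suc k) * s)) \<longlonglongrightarrow>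
      (CLINT s|std_normal_distribution. 1)"
  proof (rule integral_dominated_convergence[where w = "\<lambda>_. 1"])
    show "AE s in std_normal_distribution. (\<lambda>k. \<psi> (1 / real (Suc k) * s)) \<longlonglongrightarrow> 1"
    proof (rule AE_I2)
      fix s :: real
      have "(\<lambda>k. 1 / real (Suc k) * s) \<longlonglongrightarrow> 0"
        using tendsto_mult_right[OF LIMSEQ_inverse_real_of_nat, of s] by (simp add: divide_inverse)
      from isCont_tendsto_compose[OF assms(3) this]
      show "(\<lambda>k. \<psi> (1 / real (Suc k) * s)) \<longlonglongrightarrow> 1"
        using assms(4) by simp
    qed
  qed (auto simp: assms)
  then show ?thesis
    using N.prob_space by simp
qed

text \<open>Continuity of the limit at 0 makes its Gaussian average close to 1 at some scale;
  pointwise convergence carries this over to all but finitely many laws, and those few are treated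
  one by one.\<close>

lemma tight_of_char_convergence:
  assumes M: "\<And>n. real_distribution (M n)"
    and lim: "\<And>u. (\<lambda>n. char (M n) u) \<longlonglongrightarrow> \<psi> u" and cont: "isCont \<psi> 0"
  shows "tight M"
proof -
  interpret M: real_distribution "M n" for n by fact
  interpret N: real_distribution std_normal_distribution by (rule real_dist_normal_dist)
  have [measurable]: "\<psi> \<in> borel_measurable borel"
    by (rule borel_measurable_LIMSEQ_metric[OF M.char_measurable lim])
  have norm_\<psi>: "norm (\<psi> u) \<le> 1" for u
    by (rule tendsto_upperbound[OF tendsto_norm[OF lim]]) (auto simp: M.cmod_char_le_1)
  have \<psi>0: "\<psi> 0 = 1"
    using LIMSEQ_unique[OF lim[of 0]] by (simp add: M.char_zero)
  define a where "a \<phi> k = (CLINT s|std_normal_distribution. \<phi> (1 / real (Suc k) * s))" for \<phi> k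
  define c :: real where "c = 1 - exp (- 1 / 2)"
  have "c > 0" unfolding c_def by simp
  have "\<exists>b. 0 < b \<and> (\<forall>n. 1 - \<epsilon> < measure (M n) {-b<..b})" if "\<epsilon> > 0" for \<epsilon> :: real
  proof -
    have pos: "0 < c * \<epsilon>" using \<open>c > 0\<close> \<open>\<epsilon> > 0\<close> by simp
    have small: "eventually (\<lambda>k. norm (1 - a \<phi> k) < c * \<epsilon>) sequentially"
      if "a \<phi> \<longlonglongrightarrow> 1" for \<phi>
      using tendstoD[OF that pos] by (simp add: dist_norm norm_minus_commute)
    have "a \<psi> \<longlonglongrightarrow> 1"
      unfolding a_def by (rule gaussian_average_tendsto_1) (use norm_\<psi> cont \<psi>0 in auto)
    \<comment> \<open>The scale \<open>k0\<close> comes from the limit function and serves all large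
      n at once.\<close>
    from small[OF this] obtain k0 where k0: "norm (1 - a \<psi> k0) < c * \<epsilon>"
      by (auto simp: eventually_sequentially)
    have "(\<lambda>n. a (char (M n)) k0) \<longlonglongrightarrow> a \<psi> k0"
      unfolding a_def
      by (rule integral_dominated_convergence[where w = "\<lambda>_. 1"])
         (use lim M.cmod_char_le_1 in auto)
    then have "(\<lambda>n. norm (1 - a (char (M n)) k0)) \<longlonglongrightarrow> norm (1 - a \<psi> k0)"
      by (intro tendsto_intros)
    from order_tendstoD(2)[OF this k0] obtain n0
      where n0: "\<And>n. n \<ge> n0 \<Longrightarrow> norm (1 - a (char (M n)) k0) < c * \<epsilon>"
      by (auto simp: eventually_sequentially)
    \<comment> \<open>Each of the finitely many laws below \<open>n0\<close> has its own threshold;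
      \<open>k1\<close> is a common one.\<close>
    have "eventually (\<lambda>k. \<forall>n\<in>{..<n0}. norm (1 - a (char (M n)) k) < c * \<epsilon>) sequentially"
    proof (intro eventually_ball_finite ballI small)
      fix n
      show "a (char (M n)) \<longlonglongrightarrow> 1"
        unfolding a_def
        by (rule gaussian_average_tendsto_1) (use M.cmod_char_le_1 M.char_zero M.isCont_char in auto)
    qed simp
    then obtain k1 where k1: "\<And>n. n < n0 \<Longrightarrow> norm (1 - a (char (M n)) k1) < c * \<epsilon>"
      by (auto simp: eventually_sequentially)
    define b where "b = max (real (Suc k0)) (real (Suc k1))"
    have "1 - \<epsilon> < measure (M n) {-b<..b}" for n
    proof -
      obtain k where k: "norm (1 - a (char (M n)) k) < c * \<epsilon>" "real (Suc k) \<le> b"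
        using n0[of n] k1[of n] unfolding b_def by (metis max.cobounded1 max.cobounded2 not_le)
      have "c * measure (M n) {x. real (Suc k) \<le> \<bar>x\<bar>} \<le> norm (1 - a (char (M n)) k)"
        using tail_bound_gaussian[OF M[of n], of "1 / real (Suc k)"] unfolding c_def a_def by simp
      then have "c * measure (M n) {x. real (Suc k) \<le> \<bar>x\<bar>} < c * \<epsilon>"
        using k(1) by linarith
      then have *: "measure (M n) {x. real (Suc k) \<le> \<bar>x\<bar>} < \<epsilon>"
        using \<open>c > 0\<close> by simp
      have "measure (M n) (space (M n) - {-b<..b}) \<le> measure (M n) {x. real (Suc k) \<le> \<bar>x\<bar>}"
        by (rule M.finite_measure_mono) (use k(2) in auto)
      then show ?thesis
        using * M.prob_compl[of "{-b<..b}" n] by (simp del: M.space_eq_univ)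
    qed
    moreover have "0 < b" unfolding b_def by simp
    ultimately show ?thesis by blast
  qed
  then show ?thesis
    unfolding tight_def using M by (metis less_trans neg_less_0_iff_less)
qed

text \<open>Levy's continuity theorem without a candidate for the limit law: tightness gives a
  weakly convergent subsequence, and the characteristic function of its limit must agree with the
  pointwise limit. Every existence statement below about infinitely divisible laws rests on
  it.\<close>

lemma characteristic_function_limit:
  assumes "\<And>n. characteristic_function (\<phi> n)"
    and lim: "\<And>u. (\<lambda>n. \<phi> n u) \<longlonglongrightarrow> \<psi> u" and cont: "isCont \<psi> 0"
  shows "characteristic_function \<psi>"
proof -
  from assms(1) have "\<forall>n. \<exists>M. real_distribution M \<and> \<phi> n = char M"
    unfolding characteristic_function_def by blast
  then obtain M where M: "\<And>n. real_distribution (M n)" and \<phi>: "\<And>n. \<phi> n = char (M n)"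
    by metis
  have "tight M"
    using tight_of_char_convergence[OF M _ cont] lim by (simp add: \<phi>)
  from tight_imp_convergent_subsubsequence[OF this strict_mono_id] obtain r L
    where r: "strict_mono r" and L: "real_distribution L" and conv: "weak_conv_m (M \<circ> id \<circ> r) L"
    by auto
  have "char L u = \<psi> u" for u
  proof (rule LIMSEQ_unique)
    show "(\<lambda>n. char ((M \<circ> id \<circ> r) n) u) \<longlonglongrightarrow> char L u"
      by (rule levy_continuity1[OF _ L conv]) (simp add: M)
    show "(\<lambda>n. char ((M \<circ> id \<circ> r) n) u) \<longlonglongrightarrow> \<psi> u"
      using LIMSEQ_subseq_LIMSEQ[OF lim[of u] r] by (simp add: \<phi> comp_def)
  qed
  then have "\<psi> = char L" by auto
  then show ?thesis
    using L unfolding characteristic_function_def by blast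
qed

subsection \<open>Levy--Khintchine exponents\<close>

text \<open>This is the derivative of exp at 0. The factor n is there because the remainder will
  occur in each of n factors of a power.\<close>

lemma exp_first_order_remainder_tendsto:
  "(\<lambda>n. real n * norm (exp (z / of_nat n) - 1 - z / of_nat n)) \<longlonglongrightarrow> 0" for z :: complex
proof (cases "z = 0")
  case False
  have "((\<lambda>h. (exp (0 + h) - exp 0) / h) \<longlongrightarrow> exp (0::complex)) (at 0)"
    using DERIV_exp[of 0] unfolding DERIV_def .
  moreover have "filterlim (\<lambda>n. z / of_nat n) (at 0) sequentially"
    unfolding filterlim_at using False
    by (auto intro!: lim_const_over_n eventually_sequentiallyI[of 1])
  ultimately have "(\<lambda>n. (exp (0 + z / of_nat n) - exp 0) / (z / of_nat n)) \<longlonglongrightarrow> exp 0"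
    by (rule filterlim_compose)
  then have "(\<lambda>n. norm z * norm ((exp (0 + z / of_nat n) - exp 0) / (z / of_nat n) - 1)) \<longlonglongrightarrow>
      norm z * norm (exp (0::complex) - 1)"
    by (intro tendsto_intros)
  then have "(\<lambda>n. norm z * norm ((exp (z / of_nat n) - 1) / (z / of_nat n) - 1)) \<longlonglongrightarrow> 0"
    by simp
  moreover have "eventually (\<lambda>n. norm z * norm ((exp (z / of_nat n) - 1) / (z / of_nat n) - 1) =
      real n * norm (exp (z / of_nat n) - 1 - z / of_nat n)) sequentially"
    using eventually_gt_at_top[of 0]
  proof eventually_elim
    case (elim n)
    have "(exp (z / of_nat n) - 1) / (z / of_nat n) - 1 = of_nat n * (exp (z / of_nat n) - 1 - z / of_nat n) / z"
      using elim False by (simp add: field_simps)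
    then show ?case
      using False by (simp add: norm_mult norm_divide)
  qed
  ultimately show ?thesis
    by (rule Lim_transform_eventually)
qed simp

text \<open>The law of rare events: each of n independent trials contributes a jump with probability
  c / n and 0 otherwise, and the powers of 1 + c (\<phi> - 1) / n tend to the exponential.\<close>

lemma characteristic_function_exp_minus_1:
  assumes \<phi>: "characteristic_function \<phi>" and c: "0 \<le> c"
  shows "characteristic_function (\<lambda>u. exp (of_real c * (\<phi> u - 1)))"
proof -
  \<comment> \<open>Starting the sequence at an index above c keeps every weight c / (n + N) a
    probability.\<close>
  define N where "N = Suc (nat \<lceil>c\<rceil>)"
  have N: "c \<le> real N" "0 < N"
    unfolding N_def by linarith+
  define w where "w n u = (let p = c / real (n + N) in of_real p * \<phi> u + of_real (1 - p) * 1)" for n u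
  have w: "characteristic_function (w n)" for n
    unfolding w_def Let_def
    by (intro characteristic_function_mix \<phi> characteristic_function_1) (use c N in \<open>auto simp: field_simps\<close>)
  show ?thesis
  proof (rule characteristic_function_limit)
    show "characteristic_function (\<lambda>u. \<Prod>j<n + N. w n u)" for n
      by (intro characteristic_function_prod w)
    show "isCont (\<lambda>u. exp (of_real c * (\<phi> u - 1))) 0"
      by (intro continuous_intros characteristic_function_isCont[OF \<phi>])
    fix u
    define z where "z = of_real c * (\<phi> u - 1)"
    have "Re (\<phi> u) \<le> 1"
      using characteristic_function_norm[OF \<phi>, of u] complex_Re_le_cmod[of "\<phi> u"] by linarith
    then have Re: "Re z \<le> 0"
      unfolding z_def using c by (simp add: mult_nonneg_nonpos)
    have w_eq: "w n u = 1 + z / of_nat (n + N)" for n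
      unfolding w_def z_def Let_def by (simp add: diff_divide_distrib algebra_simps)
    \<comment> \<open>Two numbers of modulus at most 1 have m-th powers that differ by at most m
      times their distance; for the exponential this modulus bound is the sign of
      \<open>Re z\<close>.\<close>
    have "norm (w n u ^ (n + N) - exp z) \<le>
        real (n + N) * norm (exp (z / of_nat (n + N)) - 1 - z / of_nat (n + N))" for n
    proof -
      have "exp z = exp (z / of_nat (n + N)) ^ (n + N)"
        using N by (subst exp_of_nat_mult[symmetric]) (simp del: of_nat_add)
      moreover have "norm (exp (z / of_nat (n + N))) \<le> 1"
        using Re by (simp add: divide_nonpos_nonneg)
      ultimately have "norm (w n u ^ (n + N) - exp z) \<le> real (n + N) * norm (w n u - exp (z / of_nat (n + N)))"
        using norm_power_diff[of "w n u" "exp (z / of_nat (n + N))" "n + N"]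
          characteristic_function_norm[OF w] by simp
      also have "norm (w n u - exp (z / of_nat (n + N))) = norm (exp (z / of_nat (n + N)) - 1 - z / of_nat (n + N))"
        unfolding w_eq by (subst norm_minus_commute) (simp add: algebra_simps)
      finally show ?thesis .
    qed
    then have "(\<lambda>n. w n u ^ (n + N) - exp z) \<longlonglongrightarrow> 0"
      by (intro Lim_null_comparison[OF always_eventually LIMSEQ_ignore_initial_segment[OF exp_first_order_remainder_tendsto]])
         auto
    then show "(\<lambda>n. \<Prod>j<n + N. w n u) \<longlonglongrightarrow> exp (of_real c * (\<phi> u - 1))"
      unfolding z_def by (simp add: LIM_zero_iff)
  qed
qed

lemma compound_poisson_exponent:
  assumes "finite_measure K" and sets_K: "sets K = sets borel"
  obtains c \<phi> where "0 \<le> c" "c = measure K UNIV" "characteristic_function \<phi>"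
    "\<And>u. (CLINT x|K. iexp (u * x) - 1) = of_real c * (\<phi> u - 1)"
proof -
  interpret K: finite_measure K by fact
  note [measurable_cong] = sets_K
  have space_K: "space K = UNIV"
    using sets_eq_imp_space_eq[OF sets_K] by simp
  define c where "c = measure K UNIV"
  have int: "integrable K (\<lambda>x. iexp (u * x))" for u
    by (rule K.integrable_const_bound[where B = 1]) auto
  have diff: "(CLINT x|K. iexp (u * x) - 1) = (CLINT x|K. iexp (u * x)) - of_real c" for u
    using int by (simp add: c_def space_K scaleR_conv_of_real)
  show ?thesis
  proof (cases "c = 0")
    case True
    have "emeasure K A = 0" for A
      using True emeasure_mono[of A UNIV K] by (simp add: c_def K.emeasure_eq_measure sets_K)
    then have "K = null_measure K"
      by (intro measure_eqI) auto
    then have "(CLINT x|K. iexp (u * x)) = 0" for u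
      by (metis integral_null_measure)
    then show ?thesis
      using that[of c "\<lambda>_. 1"] True diff characteristic_function_1 by (auto simp: c_def)
  next
    case False
    then have "c > 0" by (simp add: c_def zero_less_measure_iff less_le)
    define M where "M = density K (\<lambda>_. ennreal (1 / c))"
    have "emeasure M UNIV = 1"
      unfolding M_def using \<open>c > 0\<close>
      by (simp add: emeasure_density K.emeasure_eq_measure c_def space_K flip: ennreal_mult)
    then have M: "real_distribution M"
      by (intro real_distribution.intro prob_spaceI real_distribution_axioms.intro)
         (auto simp: M_def sets_K space_K)
    have *: "(CLINT x|K. iexp (u * x)) = of_real c * char M u" for u
      unfolding char_def M_def using \<open>c > 0\<close>
      by (subst integral_density) (auto simp: scaleR_conv_of_real)
    show ?thesis
      using that[of c "char M"] * diff \<open>c > 0\<close> characteristic_function_char[OF M]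
      by (auto simp: c_def algebra_simps)
  qed
qed

lemma characteristic_function_compound_poisson:
  assumes "finite_measure K" "sets K = sets borel" "0 \<le> h"
  shows "characteristic_function (\<lambda>u. exp (of_real h * (CLINT x|K. iexp (u * x) - 1)))"
proof (rule compound_poisson_exponent[OF assms(1,2)])
  fix c \<phi>
  assume *: "0 \<le> c" "characteristic_function \<phi>"
    "\<And>u. (CLINT x|K. iexp (u * x) - 1) = of_real c * (\<phi> u - 1)"
  show ?thesis
    unfolding * using characteristic_function_exp_minus_1[OF *(2), of "h * c"] assms *
    by (simp add: mult.assoc)
qed

text \<open>The centering \<open>indicator {-1..1}\<close> is the one fixed in the definition of \<open>purely_discontinuous\<close>.\<close>

definition lk_integrand :: "real \<Rightarrow> real \<Rightarrow> complex" where
  "lk_integrand u x = iexp (u * x) - 1 - \<i> * of_real (u * x * indicator {-1..1} x)"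

lemma lk_integrand_measurable [measurable]: "lk_integrand u \<in> borel_measurable borel"
  unfolding lk_integrand_def by measurable

text \<open>For |x| at most 1 the centering cancels the linear term and Taylor's formula leaves a
  quadratic one; elsewhere the trivial bound 2 suffices. The right-hand side separates u from
  exactly the function that Levy measures integrate.\<close>

lemma norm_lk_integrand_le: "norm (lk_integrand u x) \<le> (2 + u\<^sup>2) * min 1 (x\<^sup>2)"
proof (cases "\<bar>x\<bar> \<le> 1")
  case True
  then have "norm (lk_integrand u x) = norm (iexp (u * x) - (\<Sum>k \<le> 1. (\<i> * of_real (u * x))^k / fact k))"
    by (auto simp: lk_integrand_def algebra_simps abs_le_iff)
  also have "\<dots> \<le> \<bar>u * x\<bar>^(Suc 1) / fact (Suc 1)"
    by (rule iexp_approx1)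
  also have "\<dots> \<le> u\<^sup>2 * x\<^sup>2"
    by (simp add: power_mult_distrib flip: power2_eq_square)
  also have "\<dots> \<le> (2 + u\<^sup>2) * min 1 (x\<^sup>2)"
    using True abs_square_le_1[of x] by (simp add: min_absorb2 mult_right_mono)
  finally show ?thesis .
next
  case False
  then have "norm (lk_integrand u x) = norm (iexp (u * x) - 1)"
    by (auto simp: lk_integrand_def abs_le_iff)
  also have "\<dots> \<le> 2"
    by (rule order_trans[OF norm_triangle_ineq4]) simp
  also have "\<dots> \<le> (2 + u\<^sup>2) * min 1 (x\<^sup>2)"
  proof -
    have "1 \<le> x\<^sup>2"
      using False abs_square_le_1[of x] by (simp add: power2_eq_square)
    then show ?thesis by simp
  qed
  finally show ?thesis .
qed

lemma levy_measure_integrable: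
  assumes L: "levy_measure L"
  shows "integrable L (\<lambda>x. min 1 (x\<^sup>2))" "integrable L (lk_integrand u)"
proof -
  have sets_L [measurable_cong]: "sets L = sets borel"
    using L unfolding levy_measure_def by auto
  show 1: "integrable L (\<lambda>x. min 1 (x\<^sup>2))"
    using L unfolding levy_measure_def by (intro integrableI_bounded) auto
  show "integrable L (lk_integrand u)"
    by (rule Bochner_Integration.integrable_bound[OF integrable_mult_right[OF 1, of "2 + u\<^sup>2"]])
       (use norm_lk_integrand_le in auto)
qed

text \<open>Compact annuli that exhaust the line without 0. The inner radius keeps the mass of a
  Levy measure finite, the outer one makes the jumps bounded.\<close>

definition jumps :: "nat \<Rightarrow> real set" where
  "jumps n = {x. 1 / real (Suc n) \<le> \<bar>x\<bar> \<and> \<bar>x\<bar> \<le> real (Suc n)}"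

lemma jumps_measurable [measurable]: "jumps n \<in> sets borel"
  unfolding jumps_def by measurable

lemma eventually_in_jumps:
  assumes "x \<noteq> 0"
  shows "eventually (\<lambda>n. x \<in> jumps n) sequentially"
proof -
  have "(\<lambda>n. 1 / real (Suc n)) \<longlonglongrightarrow> 0"
    by (rule LIMSEQ_Suc[OF lim_1_over_n])
  then have "eventually (\<lambda>n. 1 / real (Suc n) < \<bar>x\<bar>) sequentially"
    using assms by (intro order_tendstoD(2)) auto
  moreover have "eventually (\<lambda>n. \<bar>x\<bar> \<le> real n) sequentially"
    by (meson eventually_sequentiallyI nat_ceiling_le_eq)
  ultimately show ?thesis
    by eventually_elim (auto simp: jumps_def)
qed

text \<open>A density instead of a restricted space, so that the result is again a measure on all
  Borel sets of the line, as \<open>levy_measure\<close> demands.\<close>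

definition restricted :: "real measure \<Rightarrow> real set \<Rightarrow> real measure" where
  "restricted L E = density L (indicator E)"

lemma sets_restricted [simp, measurable_cong]: "sets (restricted L E) = sets L"
  unfolding restricted_def by simp

lemma restricted_integral:
  fixes f :: "real \<Rightarrow> 'b :: {banach, second_countable_topology}"
  assumes "sets L = sets borel" "E \<in> sets borel" "f \<in> borel_measurable borel"
  shows "integral\<^sup>L (restricted L E) f = (LINT x|L. indicator E x *\<^sub>R f x)"
proof -
  note [measurable_cong] = assms(1) and [measurable] = assms(2,3)
  have *: "restricted L E = density L (\<lambda>x. ennreal (indicator E x))"
    unfolding restricted_def by (simp add: ennreal_indicator)
  show "integral\<^sup>L (restricted L E) f = (LINT x|L. indicator E x *\<^sub>R f x)"
    unfolding * by (rule integral_density) auto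
qed

lemma levy_measure_restricted:
  assumes L: "levy_measure L" and E: "E \<in> sets borel"
  shows "levy_measure (restricted L E)"
proof -
  have sets_L [measurable_cong]: "sets L = sets borel"
    using L unfolding levy_measure_def by auto
  note [measurable] = E
  have "emeasure (restricted L E) {0} \<le> emeasure L {0}"
    unfolding restricted_def
    by (subst emeasure_density)
       (auto simp flip: nn_integral_indicator intro!: nn_integral_mono split: split_indicator)
  moreover have "(\<integral>\<^sup>+ x. ennreal (min 1 (x\<^sup>2)) \<partial>restricted L E) \<le> (\<integral>\<^sup>+ x. ennreal (min 1 (x\<^sup>2)) \<partial>L)"
    unfolding restricted_def
    by (subst nn_integral_density) (auto intro!: nn_integral_mono split: split_indicator)
  ultimately show ?thesis
    using L unfolding levy_measure_def by auto
qed

text \<open>On the annulus \<open>min 1 (x\<^sup>2)\<close> is at least the squared inner radius, so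
  the mass is at most a constant times the finite integral in \<open>levy_measure\<close>.\<close>

lemma finite_measure_restricted_jumps:
  assumes L: "levy_measure L"
  shows "finite_measure (restricted L (jumps n))"
proof
  have sets_L [measurable_cong]: "sets L = sets borel"
    using L unfolding levy_measure_def by auto
  have space_L: "space L = UNIV"
    using sets_eq_imp_space_eq[OF sets_L] by simp
  define a where "a = (1 / real (Suc n))\<^sup>2"
  have a: "0 < a" "a \<le> 1"
    by (auto simp: a_def field_simps power_le_one)
  have le: "indicator (jumps n) x \<le> ennreal (1 / a) * ennreal (min 1 (x\<^sup>2))" for x
  proof (cases "x \<in> jumps n")
    case True
    then have "1 / real (Suc n) \<le> \<bar>x\<bar>"
      unfolding jumps_def by simp
    from power_mono[OF this, of 2] have "a \<le> min 1 (x\<^sup>2)"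
      using a(2) unfolding a_def by simp
    then have "1 \<le> 1 / a * min 1 (x\<^sup>2)"
      using a by (simp add: field_simps)
    then show ?thesis
      using True a by (subst ennreal_mult[symmetric]) (auto simp flip: ennreal_1 intro!: ennreal_leI)
  qed simp
  have "emeasure (restricted L (jumps n)) (space (restricted L (jumps n))) =
      (\<integral>\<^sup>+ x. indicator (jumps n) x \<partial>L)"
    unfolding restricted_def by (subst emeasure_density) (auto simp: space_L)
  also have "\<dots> \<le> ennreal (1 / a) * (\<integral>\<^sup>+ x. ennreal (min 1 (x\<^sup>2)) \<partial>L)"
    by (subst nn_integral_cmult[symmetric]) (auto simp del: nn_integral_indicator intro!: nn_integral_mono le)
  also have "\<dots> < \<infinity>"
    using L unfolding levy_measure_def by (simp add: ennreal_mult_less_top)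
  finally show "emeasure (restricted L (jumps n)) (space (restricted L (jumps n))) \<noteq> \<infinity>"
    by simp
qed

text \<open>On a finite measure the centering term is integrable by itself, hence amounts to a
  deterministic drift; \<open>b\<close> is the integral of x over the jumps of size at most
  1.\<close>

lemma lk_exponent_restricted_jumps:
  assumes L: "levy_measure L"
  obtains b :: real where "\<And>u. (CLINT x|restricted L (jumps n). lk_integrand u x) =
    (CLINT x|restricted L (jumps n). iexp (u * x) - 1) - \<i> * of_real (u * b)"
proof
  interpret K: finite_measure "restricted L (jumps n)"
    by (rule finite_measure_restricted_jumps[OF L])
  have sets_L [measurable_cong]: "sets L = sets borel"
    using L unfolding levy_measure_def by auto
  define t :: "real \<Rightarrow> real" where "t x = x * indicator {-1..1} x" for x
  have [measurable]: "t \<in> borel_measurable borel" unfolding t_def by measurable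
  have 1: "integrable (restricted L (jumps n)) t"
    by (rule K.integrable_const_bound[where B = 1]) (auto simp: t_def split: split_indicator)
  have 2: "integrable (restricted L (jumps n)) (\<lambda>x. iexp (u * x) - 1)" for u
    by (rule K.integrable_const_bound[where B = 2]) (auto intro!: order_trans[OF norm_triangle_ineq4])
  fix u
  have "(CLINT x|restricted L (jumps n). lk_integrand u x) =
     (CLINT x|restricted L (jumps n). (iexp (u * x) - 1) - \<i> * of_real u * of_real (t x))"
    by (rule Bochner_Integration.integral_cong) (auto simp: lk_integrand_def t_def mult.assoc)
  also have "\<dots> = (CLINT x|restricted L (jumps n). iexp (u * x) - 1) -
      \<i> * of_real u * of_real (LINT x|restricted L (jumps n). t x)"
    using 1 2 by (subst Bochner_Integration.integral_diff) auto
  finally show "(CLINT x|restricted L (jumps n). lk_integrand u x) =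
    (CLINT x|restricted L (jumps n). iexp (u * x) - 1) - \<i> * of_real (u * (LINT x|restricted L (jumps n). t x))"
    by simp
qed

text \<open>Restricted to an annulus, the exponent is that of a compound Poisson law with a shift.
  The shifts themselves need not converge; only the centred exponents do, by dominated
  convergence.\<close>

lemma characteristic_function_levy_khintchine:
  assumes L: "levy_measure L" and h: "0 \<le> h"
  shows "characteristic_function (\<lambda>u. exp (of_real h * (CLINT x|L. lk_integrand u x)))"
proof (rule characteristic_function_limit)
  have sets_L [measurable_cong]: "sets L = sets borel"
    using L unfolding levy_measure_def by auto
  note int = levy_measure_integrable[OF L]
  show "characteristic_function (\<lambda>u. exp (of_real h * (CLINT x|restricted L (jumps n). lk_integrand u x)))" for n
  proof (rule lk_exponent_restricted_jumps[OF L, of n])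
    fix b assume b: "\<And>u. (CLINT x|restricted L (jumps n). lk_integrand u x) =
      (CLINT x|restricted L (jumps n). iexp (u * x) - 1) - \<i> * of_real (u * b)"
    have "characteristic_function (\<lambda>u.
        exp (of_real h * (CLINT x|restricted L (jumps n). iexp (u * x) - 1)) * iexp (u * (- h * b)))"
      by (intro characteristic_function_mult characteristic_function_compound_poisson
          characteristic_function_iexp finite_measure_restricted_jumps L) (auto simp: h sets_L)
    also have "(\<lambda>u. exp (of_real h * (CLINT x|restricted L (jumps n). iexp (u * x) - 1)) * iexp (u * (- h * b))) =
        (\<lambda>u. exp (of_real h * (CLINT x|restricted L (jumps n). lk_integrand u x)))"
      unfolding b by (rule ext, subst exp_add[symmetric], rule arg_cong[where f = exp], simp add: algebra_simps)
    finally show ?thesis .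
  qed
  show "(\<lambda>n. exp (of_real h * (CLINT x|restricted L (jumps n). lk_integrand u x))) \<longlonglongrightarrow>
      exp (of_real h * (CLINT x|L. lk_integrand u x))" for u
  proof -
    have "AE x in L. x \<noteq> 0"
      by (rule AE_I[where N = "{0}"]) (use L in \<open>auto simp: levy_measure_def\<close>)
    then have "AE x in L. (\<lambda>n. indicator (jumps n) x *\<^sub>R lk_integrand u x) \<longlonglongrightarrow> lk_integrand u x"
    proof eventually_elim
      case (elim x)
      show ?case
        by (rule tendsto_eventually, rule eventually_mono[OF eventually_in_jumps[OF elim]]) simp
    qed
    then have "(\<lambda>n. CLINT x|L. indicator (jumps n) x *\<^sub>R lk_integrand u x) \<longlonglongrightarrow> (CLINT x|L. lk_integrand u x)"
      by (intro integral_dominated_convergence[where w = "\<lambda>x. norm (lk_integrand u x)"])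
         (auto intro!: integrable_norm int split: split_indicator)
    then show ?thesis
      by (intro tendsto_intros) (simp add: restricted_integral sets_L)
  qed
  have "isCont (\<lambda>u. CLINT x|L. lk_integrand u x) 0"
    unfolding continuous_at_sequentially
  proof safe
    fix X :: "nat \<Rightarrow> real" assume X: "X \<longlonglongrightarrow> 0"
    \<comment> \<open>A single bound on the convergent frequencies gives a single integrable
      majorant for the whole sequence.\<close>
    then obtain B where B: "\<And>n. \<bar>X n\<bar> \<le> B"
      using convergent_imp_Bseq[of X] unfolding convergent_def Bseq_def by auto
    have "norm (lk_integrand (X n) x) \<le> (2 + B\<^sup>2) * min 1 (x\<^sup>2)" for n x
      using norm_lk_integrand_le[of "X n" x] power_mono[OF B abs_ge_zero, of n 2]
      by (elim order_trans) (auto intro!: mult_right_mono)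
    moreover have "(\<lambda>n. lk_integrand (X n) x) \<longlonglongrightarrow> lk_integrand 0 x" for x
      unfolding lk_integrand_def by (intro tendsto_intros X)
    ultimately show "((\<lambda>u. CLINT x|L. lk_integrand u x) \<circ> X) \<longlonglongrightarrow> (CLINT x|L. lk_integrand 0 x)"
      unfolding comp_def
      by (intro integral_dominated_convergence[where w = "\<lambda>x. (2 + B\<^sup>2) * min 1 (x\<^sup>2)"])
         (use levy_measure_integrable(1)[OF L] in auto)
  qed
  then show "isCont (\<lambda>u. exp (of_real h * (CLINT x|L. lk_integrand u x))) 0"
    by (intro continuous_intros)
qed

section \<open>Riemann sums\<close>

text \<open>The division is into \<open>Suc n\<close> cells, so the mesh is meaningful for every
  n.\<close>

definition grid :: "real \<Rightarrow> nat \<Rightarrow> nat \<Rightarrow> real" where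
  "grid t n j = t * real j / real (Suc n)"

lemma grid_0 [simp]: "grid t n 0 = 0"
  and grid_last [simp]: "grid t n (Suc n) = t"
  and grid_Suc: "grid t n (Suc j) = grid t n j + t / real (Suc n)"
  by (simp_all add: grid_def add_divide_distrib distrib_left del: of_nat_Suc) (simp add: add_divide_distrib distrib_left add.commute)

lemma grid_mono: "0 \<le> t \<Longrightarrow> i \<le> j \<Longrightarrow> grid t n i \<le> grid t n j"
  unfolding grid_def by (intro divide_right_mono mult_left_mono) auto

lemma grid_nonneg: "0 \<le> t \<Longrightarrow> 0 \<le> grid t n j"
  unfolding grid_def by simp

lemma grid_le: "0 \<le> t \<Longrightarrow> j \<le> Suc n \<Longrightarrow> grid t n j \<le> t"
  using grid_mono[of t j "Suc n" n] by simp

text \<open>Cells exclude their left end, so the left end of the cell of s lies strictly before s.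
  This is why Riemann sums with left end points see left limits.\<close>

lemma grid_cell:
  assumes s: "0 < s" "s \<le> t"
  obtains j where "j < Suc n" "grid t n j < s" "s \<le> grid t n (Suc j)"
    "\<And>i. i < Suc n \<Longrightarrow> s \<in> {grid t n i<..grid t n (Suc i)} \<longleftrightarrow> i = j"
proof -
  have "\<exists>j<Suc n. grid t n j < s \<and> s \<le> grid t n (Suc j)"
  proof -
    define j where "j = (LEAST j. s \<le> grid t n (Suc j))"
    have j: "s \<le> grid t n (Suc j)" and le: "j \<le> n"
      unfolding j_def using s by (auto intro: LeastI[of "\<lambda>j. s \<le> grid t n (Suc j)" n] Least_le)
    have "grid t n j < s"
    proof (cases j)
      case (Suc i)
      then show ?thesis
        using not_less_Least[of i "\<lambda>j. s \<le> grid t n (Suc j)"] by (simp add: j_def)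
    qed (use s in simp)
    then show ?thesis using j le by (intro exI[of _ j]) simp
  qed
  then obtain j where j: "j < Suc n" "grid t n j < s" "s \<le> grid t n (Suc j)" by blast
  have "s \<in> {grid t n i<..grid t n (Suc i)} \<longleftrightarrow> i = j" for i
  proof -
    consider "i < j" | "i = j" | "j < i" by linarith
    then show ?thesis
    proof cases
      case 1
      then have "grid t n (Suc i) \<le> grid t n j" using s by (intro grid_mono) auto
      then show ?thesis using 1 j by auto
    next
      case 3
      then have "grid t n (Suc j) \<le> grid t n i" using s by (intro grid_mono) auto
      then show ?thesis using 3 j by auto
    qed (use j in auto)
  qed
  with j show ?thesis using that by blast
qed

text \<open>The sum is the integral of w against the step function \<open>F n\<close>, whose value
  at s is f at the left end of the cell of s. These ends approach s strictly from the left, so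
  \<open>F n\<close> tends to l, and dominated convergence applies.\<close>

lemma left_riemann_sums_tendsto:
  fixes f l :: "real \<Rightarrow> 'b :: {banach, second_countable_topology}"
  assumes t: "0 < t" and W: "\<And>s. DERIV W s :> w s" and w: "\<And>s. isCont w s"
    and bound: "\<And>s. s \<in> {0..t} \<Longrightarrow> norm (f s) \<le> B"
    and left: "\<And>s. s \<in> {0<..t} \<Longrightarrow> (f \<longlongrightarrow> l s) (at_left s)"
  shows "(\<lambda>n. \<Sum>j<Suc n. (W (grid t n (Suc j)) - W (grid t n j)) *\<^sub>R f (grid t n j)) \<longlonglongrightarrow>
    (LINT s:{0<..t}|lborel. w s *\<^sub>R l s)"
proof -
  define F where "F n s = (\<Sum>j<Suc n. indicator {grid t n j<..grid t n (Suc j)} s *\<^sub>R f (grid t n j))"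
    for n and s :: real
  have [measurable]: "w \<in> borel_measurable borel"
    using w by (intro borel_measurable_continuous_onI continuous_at_imp_continuous_on) auto
  have int_w: "integrable lborel (\<lambda>s. indicator {a..b} s *\<^sub>R w s)" for a b
    using w by (intro borel_integrable_compact continuous_at_imp_continuous_on) auto
  have int_w': "integrable lborel (\<lambda>s. indicator {a<..b} s * w s)" for a b
    by (rule Bochner_Integration.integrable_bound[OF int_w[of a b]]) (auto split: split_indicator)
  have FTC: "(LINT s|lborel. indicator {a<..b} s * w s) = W b - W a" if "a \<le> b" for a b
  proof -
    have "(LINT s|lborel. indicator {a<..b} s * w s) = (LINT s|lborel. indicator {a..b} s *\<^sub>R w s)"
    proof (rule integral_cong_AE)
      show "AE s in lborel. indicator {a<..b} s * w s = indicator {a..b} s *\<^sub>R w s"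
        using AE_lborel_singleton[of a] by eventually_elim (auto split: split_indicator)
    qed measurable
    also have "\<dots> = W b - W a"
    proof (rule integral_FTC_atLeastAtMost[OF that])
      show "(W has_vector_derivative w x) (at x within {a..b})" for x
        using has_field_derivative_at_within[OF W] by (simp add: has_real_derivative_iff_has_vector_derivative)
      show "continuous_on {a..b} w"
        using w by (intro continuous_at_imp_continuous_on) auto
    qed
    finally show ?thesis .
  qed
  have F_eq: "\<exists>r. F n s = f r \<and> 0 \<le> r \<and> r < s \<and> s - t / real (Suc n) \<le> r" if "s \<in> {0<..t}" for n s
  proof -
    from that obtain j where j: "j < Suc n" "grid t n j < s" "s \<le> grid t n (Suc j)"
      "\<And>i. i < Suc n \<Longrightarrow> s \<in> {grid t n i<..grid t n (Suc i)} \<longleftrightarrow> i = j"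
      using grid_cell[of s t n] by auto
    have "F n s = (\<Sum>i<Suc n. if i = j then f (grid t n j) else 0)"
      unfolding F_def using j(4) by (intro sum.cong) (auto simp: indicator_def)
    also have "\<dots> = f (grid t n j)"
      using j(1) by (subst sum.delta) auto
    finally show ?thesis
      using j t by (intro exI[of _ "grid t n j"]) (auto simp: grid_nonneg grid_Suc)
  qed
  have F_0: "F n s = 0" if "s \<notin> {0<..t}" for n s
    unfolding F_def
  proof (intro sum.neutral ballI)
    fix j assume "j \<in> {..<Suc n}"
    then have "{grid t n j<..grid t n (Suc j)} \<subseteq> {0<..t}"
      using grid_nonneg[of t n j] grid_le[of t "Suc j" n] t by (auto simp del: grid_last)
    then show "indicator {grid t n j<..grid t n (Suc j)} s *\<^sub>R f (grid t n j) = 0"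
      using that by (subst indicator_simps(2)) (blast, simp)
  qed
  have [measurable]: "F n \<in> borel_measurable borel" for n
    unfolding F_def by measurable
  have F_lim: "(\<lambda>n. F n s) \<longlonglongrightarrow> indicator {0<..t} s *\<^sub>R l s" for s
  proof (cases "s \<in> {0<..t}")
    case True
    from F_eq[OF True] obtain r where r: "\<And>n. F n s = f (r n)" "\<And>n. r n < s"
      "\<And>n. s - t / real (Suc n) \<le> r n" by metis
    have "(\<lambda>n. s - t * (1 / real (Suc n))) \<longlonglongrightarrow> s - t * 0"
      by (intro tendsto_intros LIMSEQ_Suc[OF lim_1_over_n])
    then have "r \<longlonglongrightarrow> s"
      using r by (intro tendsto_sandwich[of "\<lambda>n. s - t / real (Suc n)" r _ "\<lambda>_. s" s])
        (auto intro!: always_eventually less_imp_le simp del: of_nat_Suc)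
    then have "filterlim r (at_left s) sequentially"
      unfolding filterlim_at using r(2) by (auto intro!: always_eventually less_imp_neq)
    from filterlim_compose[OF left[OF True] this] show ?thesis
      using True by (simp add: r)
  qed (simp add: F_0)
  have "(LINT s|lborel. w s *\<^sub>R F n s) = (\<Sum>j<Suc n. (W (grid t n (Suc j)) - W (grid t n j)) *\<^sub>R f (grid t n j))" for n
  proof -
    have "(LINT s|lborel. w s *\<^sub>R F n s) =
      (LINT s|lborel. (\<Sum>j<Suc n. (indicator {grid t n j<..grid t n (Suc j)} s * w s) *\<^sub>R f (grid t n j)))"
      unfolding F_def by (simp only: scaleR_sum_right scaleR_scaleR mult.commute)
    also have "\<dots> = (\<Sum>j<Suc n. (LINT s|lborel. indicator {grid t n j<..grid t n (Suc j)} s * w s) *\<^sub>R f (grid t n j))"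
      by (subst Bochner_Integration.integral_sum)
         (intro integrable_scaleR_left int_w', simp only: integral_scaleR_left[OF int_w'])
    also have "\<dots> = (\<Sum>j<Suc n. (W (grid t n (Suc j)) - W (grid t n j)) *\<^sub>R f (grid t n j))"
      using t by (intro sum.cong refl) (subst FTC, auto intro!: grid_mono)
    finally show ?thesis .
  qed
  moreover have "(\<lambda>n. LINT s|lborel. w s *\<^sub>R F n s) \<longlonglongrightarrow> (LINT s|lborel. w s *\<^sub>R (indicator {0<..t} s *\<^sub>R l s))"
  proof (rule integral_dominated_convergence[where w = "\<lambda>s. norm (indicator {0..t} s *\<^sub>R w s) * B"])
    \<comment> \<open>Measurability of l is not assumed; it is inherited from the step
      functions.\<close>
    show "(\<lambda>s. w s *\<^sub>R (indicator {0<..t} s *\<^sub>R l s)) \<in> borel_measurable lborel"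
      by (rule borel_measurable_LIMSEQ_metric[where f = "\<lambda>n s. w s *\<^sub>R F n s"])
         (measurable, intro tendsto_intros F_lim)
    show "integrable lborel (\<lambda>s. norm (indicator {0..t} s *\<^sub>R w s) * B)"
      by (intro integrable_mult_left integrable_norm int_w)
    show "AE s in lborel. (\<lambda>n. w s *\<^sub>R F n s) \<longlonglongrightarrow> w s *\<^sub>R (indicator {0<..t} s *\<^sub>R l s)"
      by (intro AE_I2 tendsto_intros F_lim)
    show "AE s in lborel. norm (w s *\<^sub>R F n s) \<le> norm (indicator {0..t} s *\<^sub>R w s) * B" for n
    proof (rule AE_I2)
      fix s
      show "norm (w s *\<^sub>R F n s) \<le> norm (indicator {0..t} s *\<^sub>R w s) * B"
      proof (cases "s \<in> {0<..t}")
        case True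
        from F_eq[OF True, of n] obtain r where "F n s = f r" "0 \<le> r" "r < s" by blast
        then show ?thesis using bound[of r] True by (auto intro!: mult_left_mono)
      next
        case False
        have "0 \<le> B" using bound[of 0] t order_trans[OF norm_ge_zero, of "f 0" B] by simp
        then show ?thesis using F_0[OF False] by simp
      qed
    qed
  qed measurable
  ultimately show ?thesis
    unfolding set_lebesgue_integral_def by (simp add: mult.commute)
qed

text \<open>One-sided limits bound f on either side of each point, the value at the point is added
  separately, and bisection glues the local bounds.\<close>

lemma cadlag_bounded:
  assumes f: "cadlag f"
  obtains B where "\<And>s. s \<in> {0..t} \<Longrightarrow> \<bar>f s\<bar> \<le> B"
proof -
  have near: "\<exists>d>0. bounded (f ` ({x-d<..<x+d} \<inter> {0..}))" if "0 \<le> x" for x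
  proof -
    have bdd: "\<exists>S. eventually (\<lambda>s. f s \<in> S) F \<and> bounded S" if "(f \<longlongrightarrow> l) F" for l F
      using topological_tendstoD[OF that, of "ball l 1"] by (intro exI[of _ "ball l 1"]) simp
    have "(f \<longlongrightarrow> f x) (at_right x)"
      using f that unfolding cadlag_def by blast
    from bdd[OF this] obtain S b where S: "bounded S" "x < b" "\<And>s. x < s \<Longrightarrow> s < b \<Longrightarrow> f s \<in> S"
      unfolding eventually_at_right_field by auto
    obtain R a where R: "bounded R" "a < x" "\<And>s. 0 \<le> s \<Longrightarrow> a < s \<Longrightarrow> s < x \<Longrightarrow> f s \<in> R"
    proof (cases "x = 0")
      case True
      \<comment> \<open>There are no times before 0, so the empty set and any negative a will
        do.\<close>
      then show ?thesis by (intro that[of "{}" "-1"]) auto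
    next
      case False
      then have "\<exists>l. (f \<longlongrightarrow> l) (at_left x)"
        using f \<open>0 \<le> x\<close> unfolding cadlag_def by auto
      then obtain l where "(f \<longlongrightarrow> l) (at_left x)" ..
      from bdd[OF this] obtain R a where "bounded R" "a < x" "\<And>s. a < s \<Longrightarrow> s < x \<Longrightarrow> f s \<in> R"
        unfolding eventually_at_left_field by auto
      then show ?thesis using that[of R a] by blast
    qed
    define d where "d = min (b - x) (x - a)"
    have "f s \<in> insert (f x) (R \<union> S)" if "s \<in> {x-d<..<x+d} \<inter> {0..}" for s
    proof (cases s x rule: linorder_cases)
      case less
      then have "f s \<in> R" using that by (intro R(3)) (auto simp: d_def)
      then show ?thesis by simp
    next
      case greater
      then have "f s \<in> S" using that by (intro S(3)) (auto simp: d_def)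
      then show ?thesis by simp
    qed simp
    then have "f ` ({x-d<..<x+d} \<inter> {0..}) \<subseteq> insert (f x) (R \<union> S)" by blast
    moreover have "0 < d" using S(2) R(2) by (simp add: d_def)
    ultimately show ?thesis
      using S(1) R(1) bounded_subset[of "insert (f x) (R \<union> S)"] by (intro exI[of _ d]) auto
  qed
  show ?thesis
  proof (cases "0 \<le> t")
    case True
    \<comment> \<open>The seemingly redundant intersection fits the predicate used for the
      bisection: small intervals around an end point may stick out of \<open>{0..t}\<close>.\<close>
    have "bounded (f ` ({0..t} \<inter> {0..t}))"
    proof (rule Bolzano[where P = "\<lambda>a b. bounded (f ` ({a..b} \<inter> {0..t}))"])
      show "0 \<le> t" by fact
    next
      fix a b c assume "bounded (f ` ({a..b} \<inter> {0..t}))" "bounded (f ` ({b..c} \<inter> {0..t}))"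
      moreover have "{a..c} \<inter> {0..t} \<subseteq> ({a..b} \<inter> {0..t}) \<union> ({b..c} \<inter> {0..t})"
        by (auto simp del: Int_atLeastAtMost)
      then have "f ` ({a..c} \<inter> {0..t}) \<subseteq> f ` ({a..b} \<inter> {0..t}) \<union> f ` ({b..c} \<inter> {0..t})"
        unfolding image_Un[symmetric] by (rule image_mono)
      ultimately show "bounded (f ` ({a..c} \<inter> {0..t}))"
        by (meson bounded_Un bounded_subset)
    next
      fix x assume "0 \<le> x" "x \<le> t"
      from near[OF this(1)] obtain d where d: "d > 0" "bounded (f ` ({x-d<..<x+d} \<inter> {0..}))" by blast
      show "\<exists>d>0. \<forall>a b. a \<le> x \<and> x \<le> b \<and> b - a < d \<longrightarrow> bounded (f ` ({a..b} \<inter> {0..t}))"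
      proof (intro exI[of _ d] conjI allI impI d(1))
        fix a b assume "a \<le> x \<and> x \<le> b \<and> b - a < d"
        then have "f ` ({a..b} \<inter> {0..t}) \<subseteq> f ` ({x-d<..<x+d} \<inter> {0..})" by auto
        then show "bounded (f ` ({a..b} \<inter> {0..t}))" using d(2) bounded_subset by blast
      qed
    qed
    then obtain B where "\<forall>s\<in>{0..t}. \<bar>f s\<bar> \<le> B"
      by (auto simp: bounded_iff)
    then show ?thesis
      using that[of B] by blast
  qed (use that in auto)
qed

text \<open>Summation by parts is the discrete form of the integration by parts in
  \<open>exp_integral\<close>. The weights sit at right end points so that, after it, the path is
  evaluated at left end points and its left limits appear.\<close>

lemma exp_integral_riemann_sums:
  assumes cadlag: "cadlag (\<lambda>t. Y t \<omega>)" and Y0: "Y 0 \<omega> = 0" and t: "0 < t"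
  shows "(\<lambda>n. \<Sum>j<Suc n. exp (- grid t n (Suc j)) * (Y (grid t n (Suc j)) \<omega> - Y (grid t n j) \<omega>)) \<longlonglongrightarrow>
    exp_integral Y t \<omega>"
proof -
  define f where "f s = Y s \<omega>" for s
  obtain B where B: "\<And>s. s \<in> {0..t} \<Longrightarrow> \<bar>f s\<bar> \<le> B"
    using cadlag_bounded[OF cadlag, of t] unfolding f_def by blast
  have left: "(f \<longlongrightarrow> Lim (at_left s) f) (at_left s)" if "0 < s" for s
  proof -
    have "\<exists>l. (f \<longlongrightarrow> l) (at_left s)"
      using cadlag that unfolding cadlag_def f_def by blast
    then obtain l where l: "(f \<longlongrightarrow> l) (at_left s)" ..
    then show ?thesis
      using tendsto_Lim[OF trivial_limit_at_left_real l] by simp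
  qed
  have "(\<lambda>n. \<Sum>j<Suc n. (- exp (- grid t n (Suc j)) - - exp (- grid t n j)) *\<^sub>R f (grid t n j)) \<longlonglongrightarrow>
    (LINT s:{0<..t}|lborel. exp (- s) *\<^sub>R Lim (at_left s) f)"
    by (rule left_riemann_sums_tendsto[OF t, where B = B])
       (auto intro!: derivative_eq_intros continuous_intros B left)
  then have "(\<lambda>n. exp (- t) * f t +
      (\<Sum>j<Suc n. (- exp (- grid t n (Suc j)) - - exp (- grid t n j)) *\<^sub>R f (grid t n j))) \<longlonglongrightarrow>
    exp (- t) * f t + (LINT s:{0<..t}|lborel. exp (- s) *\<^sub>R Lim (at_left s) f)"
    by (intro tendsto_intros)
  moreover have "exp (- t) * f t +
      (\<Sum>j<Suc n. (- exp (- grid t n (Suc j)) - - exp (- grid t n j)) *\<^sub>R f (grid t n j)) =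
    (\<Sum>j<Suc n. exp (- grid t n (Suc j)) * (f (grid t n (Suc j)) - f (grid t n j)))" for n
  proof -
    have "(\<Sum>j<Suc n. exp (- grid t n (Suc j)) * (f (grid t n (Suc j)) - f (grid t n j))) -
        (\<Sum>j<Suc n. (- exp (- grid t n (Suc j)) - - exp (- grid t n j)) *\<^sub>R f (grid t n j)) =
      (\<Sum>j<Suc n. exp (- grid t n (Suc j)) * f (grid t n (Suc j)) - exp (- grid t n j) * f (grid t n j))"
      unfolding sum_subtractf[symmetric] by (intro sum.cong) (auto simp: algebra_simps)
    \<comment> \<open>The sum telescopes, and its lower boundary term vanishes because the path
      starts at 0.\<close>
    also have "\<dots> = exp (- t) * f t"
      using Y0 by (subst sum_lessThan_telescope) (simp add: f_def)
    finally show ?thesis by simp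
  qed
  ultimately show ?thesis
    unfolding exp_integral_def f_def[symmetric] by (simp add: mult.commute del: sum.lessThan_Suc)
qed

section \<open>Exponentially discounted compound Poisson integrals\<close>

text \<open>The exponent k of the overview: the uncentred counterpart of the integral of
  \<open>lk_integrand\<close>, from which it differs by a drift when K lives on an annulus.\<close>

definition cp_exponent :: "real measure \<Rightarrow> real \<Rightarrow> complex" where
  "cp_exponent K u = (CLINT x|K. iexp (u * x) - 1)"

text \<open>Positive finite mass is the rate of an exponential waiting time; the bound R gives the
  exponent a derivative at 0; jumps different from 0 make the resulting law non-degenerate.\<close>

locale bounded_jump_measure =
  fixes K :: "real measure" and R :: real
  assumes finite_K: "finite_measure K" and sets_K [measurable_cong]: "sets K = sets borel"
    and R_pos: "0 < R" and bounded_jumps: "AE x in K. x \<noteq> 0 \<and> \<bar>x\<bar> \<le> R"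
    and rate_pos: "0 < measure K UNIV"
begin

sublocale finite_measure K by (rule finite_K)

lemma space_K [simp]: "space K = UNIV"
  using sets_eq_imp_space_eq[OF sets_K] by simp

abbreviation rate :: real where "rate \<equiv> measure K UNIV"

lemma exponent_normalised:
  "\<exists>\<phi>. characteristic_function \<phi> \<and> (\<forall>u. cp_exponent K u = of_real rate * (\<phi> u - 1))"
  using compound_poisson_exponent[OF finite_K sets_K] unfolding cp_exponent_def by metis

lemma isCont_exponent: "isCont (cp_exponent K) u"
proof -
  obtain \<phi> where \<phi>: "characteristic_function \<phi>" "\<And>u. cp_exponent K u = of_real rate * (\<phi> u - 1)"
    using exponent_normalised by blast
  have "cp_exponent K = (\<lambda>u. of_real rate * (\<phi> u - 1))" using \<phi>(2) by auto
  then show ?thesis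
    using characteristic_function_isCont[OF \<phi>(1)] by (auto intro!: continuous_intros)
qed

lemma exponent_0 [simp]: "cp_exponent K 0 = 0"
  by (simp add: cp_exponent_def)

lemma norm_exponent_le: "norm (cp_exponent K u) \<le> 2 * rate"
proof -
  obtain \<phi> where \<phi>: "characteristic_function \<phi>" "\<And>u. cp_exponent K u = of_real rate * (\<phi> u - 1)"
    using exponent_normalised by blast
  have "norm (\<phi> u - 1) \<le> 2"
    using norm_triangle_ineq4[of "\<phi> u" 1] characteristic_function_norm[OF \<phi>(1), of u] by simp
  then show ?thesis
    using rate_pos by (simp add: \<phi>(2) norm_mult)
qed

definition mean_jump :: real where "mean_jump = (LINT x|K. x)"

text \<open>The difference quotient of \<open>cp_exponent K\<close> at \<open>0\<close>, continued by the derivative.\<close>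

definition slope :: "real \<Rightarrow> complex" where
  "slope v = (if v = 0 then \<i> * of_real mean_jump else cp_exponent K v / of_real v)"

lemma slope_mult: "v *\<^sub>R slope v = cp_exponent K v"
  by (simp add: slope_def scaleR_conv_of_real)

text \<open>Bounded jumps have a first and a second moment, so the exponent is i v times the mean up
  to an error of order v^2; dividing by v leaves order |v|.\<close>

lemma norm_slope_diff_le: "norm (slope v - slope 0) \<le> \<bar>v\<bar> * (R\<^sup>2 * rate)"
proof (cases "v = 0")
  case False
  have int_x: "integrable K (\<lambda>x. x)"
    by (rule integrable_const_bound[where B = R]) (use bounded_jumps in auto)
  have int_e: "integrable K (\<lambda>x. iexp (v * x) - 1)"
    by (rule integrable_const_bound[where B = 2]) (auto intro!: order_trans[OF norm_triangle_ineq4])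
  have "cp_exponent K v - \<i> * of_real (v * mean_jump) =
      (CLINT x|K. (iexp (v * x) - 1) - \<i> * of_real v * of_real x)"
    using int_x int_e unfolding cp_exponent_def mean_jump_def
    by (subst Bochner_Integration.integral_diff) auto
  also have "norm \<dots> \<le> (LINT x|K. v\<^sup>2 * R\<^sup>2)"
  proof (rule order_trans[OF integral_norm_bound integral_mono_AE])
    show "integrable K (\<lambda>x. norm ((iexp (v * x) - 1) - \<i> * of_real v * of_real x))"
      by (rule integrable_norm, rule Bochner_Integration.integrable_diff[OF int_e]) (use int_x in auto)
    have "norm ((iexp (v * x) - 1) - \<i> * of_real v * of_real x) \<le> v\<^sup>2 * R\<^sup>2" if "\<bar>x\<bar> \<le> R" for x
    proof -
      have "norm ((iexp (v * x) - 1) - \<i> * of_real v * of_real x) =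
          norm (iexp (v * x) - (\<Sum>k \<le> 1. (\<i> * of_real (v * x))^k / fact k))"
        by (simp add: algebra_simps)
      also have "\<dots> \<le> \<bar>v * x\<bar>^(Suc 1) / fact (Suc 1)"
        by (rule iexp_approx1)
      also have "\<dots> \<le> v\<^sup>2 * x\<^sup>2"
        by (simp add: power_mult_distrib flip: power2_eq_square)
      also have "\<dots> \<le> v\<^sup>2 * R\<^sup>2"
        using power_mono[OF that, of 2] by (simp add: mult_left_mono)
      finally show ?thesis .
    qed
    then show "AE x in K. norm ((iexp (v * x) - 1) - \<i> * of_real v * of_real x) \<le> v\<^sup>2 * R\<^sup>2"
      using bounded_jumps by auto
  qed auto
  finally have *: "norm (cp_exponent K v - \<i> * of_real (v * mean_jump)) \<le> v\<^sup>2 * R\<^sup>2 * rate"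
    by (simp add: ac_simps)
  have "norm (slope v - slope 0) = norm ((cp_exponent K v - \<i> * of_real (v * mean_jump)) / of_real v)"
    using False by (simp add: slope_def diff_divide_distrib)
  also have "\<dots> \<le> v\<^sup>2 * R\<^sup>2 * rate / \<bar>v\<bar>"
    unfolding norm_divide using * by (simp add: divide_right_mono)
  also have "\<dots> = \<bar>v\<bar> * (R\<^sup>2 * rate)"
    using False by (cases "0 \<le> v") (auto simp: power2_eq_square)
  finally show ?thesis .
qed simp

lemma isCont_slope: "isCont slope v"
proof (cases "v = 0")
  case True
  have "((\<lambda>v. slope v - slope 0) \<longlongrightarrow> 0) (at 0)"
  proof (rule Lim_null_comparison)
    show "eventually (\<lambda>v. norm (slope v - slope 0) \<le> \<bar>v\<bar> * (R\<^sup>2 * rate)) (at 0)"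
      using norm_slope_diff_le by simp
    show "((\<lambda>v. \<bar>v\<bar> * (R\<^sup>2 * rate)) \<longlongrightarrow> 0) (at 0)"
      by (auto intro!: tendsto_eq_intros)
  qed
  then show ?thesis
    using True by (simp add: isCont_def LIM_zero_iff)
next
  case False
  have "isCont (\<lambda>v. cp_exponent K v / of_real v) v"
    using False by (intro continuous_intros isCont_exponent) auto
  moreover have "eventually (\<lambda>v. v \<in> -{0}) (nhds v)"
    using False by (intro eventually_nhds_in_open) auto
  then have "eventually (\<lambda>v. slope v = cp_exponent K v / of_real v) (nhds v)"
    by eventually_elim (simp add: slope_def)
  ultimately show ?thesis
    using isCont_cong by fastforce
qed

text \<open>
  The substitution \<open>v = u * exp (- s)\<close> turns the integral of \<open>cp_exponent K (u * exp (- s))\<close> over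
  \<open>s > 0\<close> into a proper integral.
\<close>

definition G :: "real \<Rightarrow> complex" where
  "G u = (LBINT v=0..u. slope v)"

lemma G_0 [simp]: "G 0 = 0"
  unfolding G_def by (simp add: zero_ereal_def)

lemma has_vector_derivative_G: "(G has_vector_derivative slope u) (at u)"
proof -
  \<comment> \<open>The margin of 1 makes u an interior point, so that the one-interval derivative
    becomes a full one.\<close>
  define b where "b = \<bar>u\<bar> + 1"
  have "((\<lambda>u. LBINT v=0..u. slope v) has_vector_derivative slope u) (at u within {-b..b})"
    unfolding zero_ereal_def
    by (rule interval_integral_FTC2)
       (auto simp: b_def intro!: continuous_at_imp_continuous_on isCont_slope)
  then have "((\<lambda>u. LBINT v=0..u. slope v) has_vector_derivative slope u) (at u within {-b<..<b})"
    by (rule has_vector_derivative_within_subset) auto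
  then show ?thesis
    unfolding G_def[abs_def] by (subst (asm) at_within_open) (auto simp: b_def)
qed

lemma isCont_G: "isCont G u"
  using has_vector_derivative_G has_vector_derivative_continuous by blast

text \<open>The inner derivative of v = u * exp (- s) is - v, and v times the slope at v is the
  exponent itself; the quotient by v disappears.\<close>

lemma has_vector_derivative_G_exp:
  "((\<lambda>s. G (u * exp (- s))) has_vector_derivative - cp_exponent K (u * exp (- s))) (at s)"
proof -
  have "((\<lambda>s. u * exp (- s)) has_vector_derivative - (u * exp (- s))) (at s)"
    by (auto intro!: derivative_eq_intros simp flip: has_real_derivative_iff_has_vector_derivative)
  from vector_diff_chain_at[OF this has_vector_derivative_G]
  show ?thesis by (simp add: comp_def slope_mult)
qed

text \<open>Right end points are used here, to match the weights of the Riemann sums along the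
  paths; the general lemma is about left end points, and the two sums differ by a telescoping
  boundary term.\<close>

lemma exponent_riemann_sums:
  assumes t: "0 < t"
  shows "(\<lambda>n. \<Sum>j<Suc n. of_real (t / real (Suc n)) * cp_exponent K (u * exp (- grid t n (Suc j)))) \<longlonglongrightarrow>
    G u - G (u * exp (- t))"
proof -
  define f where "f s = cp_exponent K (u * exp (- s))" for s
  have cont: "isCont f s" for s
    unfolding f_def by (rule isCont_o2[OF _ isCont_exponent]) (intro continuous_intros)
  have "(\<lambda>n. \<Sum>j<Suc n. (grid t n (Suc j) - grid t n j) *\<^sub>R f (grid t n j)) \<longlonglongrightarrow>
      (LINT s:{0<..t}|lborel. 1 *\<^sub>R f s)"
  proof (rule left_riemann_sums_tendsto[OF t, where B = "2 * rate"])
    show "(f \<longlongrightarrow> f s) (at_left s)" for s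
      using cont[of s] unfolding isCont_def by (rule tendsto_within_subset) auto
  qed (auto simp: f_def norm_exponent_le)
  moreover have "(LINT s:{0<..t}|lborel. 1 *\<^sub>R f s) = G u - G (u * exp (- t))"
  proof -
    have "(LINT s:{0<..t}|lborel. 1 *\<^sub>R f s) = (LINT s:{0..t}|lborel. f s)"
      unfolding set_lebesgue_integral_def
    proof (rule integral_cong_AE)
      have [measurable]: "f \<in> borel_measurable borel"
        using cont by (intro borel_measurable_continuous_onI continuous_at_imp_continuous_on) auto
      show "(\<lambda>s. indicator {0<..t} s *\<^sub>R 1 *\<^sub>R f s) \<in> borel_measurable lborel"
        "(\<lambda>s. indicator {0..t} s *\<^sub>R f s) \<in> borel_measurable lborel"
        by measurable
      show "AE s in lborel. indicator {0<..t} s *\<^sub>R 1 *\<^sub>R f s = indicator {0..t} s *\<^sub>R f s"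
        using AE_lborel_singleton[of 0] by eventually_elim (auto split: split_indicator)
    qed
    also have "\<dots> = - G (u * exp (- t)) - - G (u * exp (- 0))"
      unfolding set_lebesgue_integral_def
    proof (rule integral_FTC_atLeastAtMost)
      show "((\<lambda>s. - G (u * exp (- s))) has_vector_derivative f s) (at s within {0..t})" for s
        using has_vector_derivative_minus[OF has_vector_derivative_G_exp[of u s]]
        by (simp add: f_def has_vector_derivative_at_within)
      show "continuous_on {0..t} f"
        using cont by (intro continuous_at_imp_continuous_on) auto
    qed (use t in simp)
    finally show ?thesis by simp
  qed
  \<comment> \<open>This is the boundary term: the mesh times the total increment of
    \<open>f\<close>, which vanishes in the limit.\<close>
  moreover have "(\<lambda>n. of_real t * (f t - f 0) * of_real (1 / real (Suc n))) \<longlonglongrightarrow> of_real t * (f t - f 0) * of_real 0"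
    by (intro tendsto_intros LIMSEQ_Suc[OF lim_1_over_n])
  ultimately have "(\<lambda>n. (\<Sum>j<Suc n. (grid t n (Suc j) - grid t n j) *\<^sub>R f (grid t n j)) +
      of_real t * (f t - f 0) * of_real (1 / real (Suc n))) \<longlonglongrightarrow> G u - G (u * exp (- t)) + 0"
    by (intro tendsto_add) auto
  moreover have "(\<Sum>j<Suc n. (grid t n (Suc j) - grid t n j) *\<^sub>R f (grid t n j)) +
      of_real t * (f t - f 0) * of_real (1 / real (Suc n)) =
      (\<Sum>j<Suc n. of_real (t / real (Suc n)) * f (grid t n (Suc j)))" for n
  proof -
    have rearrange: "b + c = a" if "a - b = c" for a b c :: complex
      using that by auto
    have "(\<Sum>j<Suc n. of_real (t / real (Suc n)) * f (grid t n (Suc j))) -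
        (\<Sum>j<Suc n. (grid t n (Suc j) - grid t n j) *\<^sub>R f (grid t n j)) =
        of_real (t / real (Suc n)) * (\<Sum>j<Suc n. f (grid t n (Suc j)) - f (grid t n j))"
      unfolding sum_subtractf[symmetric] sum_distrib_left
      by (intro sum.cong) (auto simp: grid_Suc algebra_simps scaleR_conv_of_real)
    also have "\<dots> = of_real (t / real (Suc n)) * (f t - f 0)"
      by (subst sum_lessThan_telescope) simp
    also have "\<dots> = of_real t * (f t - f 0) * of_real (1 / real (Suc n))"
      by simp
    finally show ?thesis by (rule rearrange)
  qed
  ultimately show ?thesis
    by (simp add: f_def del: sum.lessThan_Suc)
qed

lemma G_scaled_tendsto_0: "(\<lambda>m. G (u * exp (- real (Suc m)))) \<longlonglongrightarrow> 0"
proof -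
  have "(\<lambda>m. exp (- real (Suc m))) \<longlonglongrightarrow> 0"
    by (rule LIMSEQ_Suc) real_asymp
  then have "(\<lambda>m. u * exp (- real (Suc m))) \<longlonglongrightarrow> u * 0"
    by (intro tendsto_intros)
  from isCont_tendsto_compose[OF isCont_G this] show ?thesis by simp
qed

text \<open>Two nested limits. Up to time t, the grid products are characteristic functions of sums
  of independent scaled compound Poisson variables; then t tends to infinity, where the remaining
  exponent \<open>G (u * exp (- t))\<close> vanishes.\<close>

lemma characteristic_function_exp_G: "characteristic_function (\<lambda>u. exp (G u))"
proof (rule characteristic_function_limit)
  fix m
  define t where "t = real (Suc m)"
  have t: "0 < t" by (simp add: t_def)
  show "characteristic_function (\<lambda>u. exp (G u - G (u * exp (- real (Suc m)))))"
    unfolding t_def[symmetric]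
  proof (rule characteristic_function_limit)
    show "characteristic_function (\<lambda>u. \<Prod>j<Suc n.
        exp (of_real (t / real (Suc n)) * cp_exponent K (u * exp (- grid t n (Suc j)))))" for n
      unfolding cp_exponent_def using t
      by (intro characteristic_function_prod
          characteristic_function_scale[OF characteristic_function_compound_poisson] finite_K sets_K) simp
    show "isCont (\<lambda>u. exp (G u - G (u * exp (- t)))) 0"
    proof -
      have "isCont (\<lambda>u. G (u * exp (- t))) 0"
        by (rule isCont_o2[OF _ isCont_G]) (intro continuous_intros)
      then show ?thesis by (intro continuous_intros isCont_G)
    qed
    show "(\<lambda>n. \<Prod>j<Suc n. exp (of_real (t / real (Suc n)) * cp_exponent K (u * exp (- grid t n (Suc j)))))
        \<longlonglongrightarrow> exp (G u - G (u * exp (- t)))" for u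
      unfolding exp_sum[OF finite_lessThan, symmetric] by (intro tendsto_exp exponent_riemann_sums t)
  qed
next
  show "(\<lambda>m. exp (G u - G (u * exp (- real (Suc m))))) \<longlonglongrightarrow> exp (G u)" for u
    using tendsto_exp[OF tendsto_diff[OF tendsto_const G_scaled_tendsto_0]] by simp
  show "isCont (\<lambda>u. exp (G u)) 0"
    by (intro continuous_intros isCont_G)
qed

text \<open>
  The integrand is the derivative of \<open>- exp (- rate * s) * exp (G (u * exp (- s)))\<close> in \<open>s\<close>.
\<close>

lemma exp_G_fixed_point:
  assumes \<phi>: "characteristic_function \<phi>" "\<And>u. cp_exponent K u = of_real rate * (\<phi> u - 1)"
  shows "(CLINT s|density lborel (exponential_density rate). \<phi> (u * exp (- s)) * exp (G (u * exp (- s)))) = exp (G u)"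
proof -
  define E where "E s = exp (G (u * exp (- s)))" for s
  define h where "h s = of_real (rate * exp (- s * rate)) * (\<phi> (u * exp (- s)) * E s)" for s
  have cont_E: "isCont E s" for s
    unfolding E_def
    by (intro continuous_intros has_vector_derivative_continuous[OF has_vector_derivative_G_exp])
  have cont_h: "isCont h s" for s
  proof -
    have "isCont (\<lambda>s. \<phi> (u * exp (- s))) s"
      by (rule isCont_o2[OF _ characteristic_function_isCont[OF \<phi>(1)]]) (intro continuous_intros)
    then show ?thesis
      unfolding h_def by (intro continuous_intros cont_E)
  qed
  have [measurable]: "h \<in> borel_measurable borel" "E \<in> borel_measurable borel" "\<phi> \<in> borel_measurable borel"
    using cont_h cont_E characteristic_function_measurable[OF \<phi>(1)]
    by (auto intro!: borel_measurable_continuous_onI continuous_at_imp_continuous_on)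
  have norm_E: "norm (E s) \<le> 1" for s
    unfolding E_def by (rule characteristic_function_norm[OF characteristic_function_exp_G])
  have norm_\<phi>: "norm (\<phi> v) \<le> 1" for v
    by (rule characteristic_function_norm[OF \<phi>(1)])
  have deriv_E: "(E has_vector_derivative - cp_exponent K (u * exp (- s)) * E s) (at s)" for s
  proof -
    have "((exp \<circ> (\<lambda>s. G (u * exp (- s)))) has_vector_derivative
        - cp_exponent K (u * exp (- s)) * exp (G (u * exp (- s)))) (at s)"
      by (rule field_vector_diff_chain_at[OF has_vector_derivative_G_exp DERIV_exp])
    then show ?thesis by (simp add: E_def[abs_def] comp_def)
  qed
  have deriv: "((\<lambda>s. - of_real (exp (- s * rate)) * E s) has_vector_derivative h s) (at s)" for s
  proof -
    have 1: "((\<lambda>s. exp (- s * rate)) has_real_derivative - rate * exp (- s * rate)) (at s)"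
      by (auto intro!: derivative_eq_intros)
    \<comment> \<open>The \<open>rate\<close> produced by differentiating the exponential cancels
      the - \<open>rate\<close> inside the exponent \<open>rate * (\<phi> - 1)\<close>; only the
      term with \<phi> survives.\<close>
    show ?thesis
      by (rule has_vector_derivative_eq_rhs[OF has_vector_derivative_mult[OF
          has_vector_derivative_minus[OF has_vector_derivative_of_real[OF 1]] deriv_E]])
         (simp add: h_def \<phi>(2) algebra_simps)
  qed
  have dens: "integrable lborel (exponential_density rate)"
  proof -
    interpret prob_space "density lborel (exponential_density rate)"
      by (rule prob_space_exponential_density[OF rate_pos])
    have "integrable (density lborel (exponential_density rate)) (\<lambda>_. 1::real)" by simp
    then show ?thesis
      using rate_pos by (subst (asm) integrable_density) (auto simp: exponential_density_nonneg)
  qed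
  \<comment> \<open>At s = 0 the exponential density equals \<open>rate\<close> while the indicator
    is 0, so the two sides agree only off a null set.\<close>
  have h_eq: "indicator {0<..} s *\<^sub>R h s = exponential_density rate s *\<^sub>R (\<phi> (u * exp (- s)) * E s)" if "s \<noteq> 0" for s
    using that by (auto simp: exponential_density_def h_def scaleR_conv_of_real split: split_indicator)
  have int_h: "set_integrable lborel {0<..} h"
    unfolding set_integrable_def
  proof (rule Bochner_Integration.integrable_bound[OF dens])
    show "AE s in lborel. norm (indicator {0<..} s *\<^sub>R h s) \<le> norm (exponential_density rate s)"
      using AE_lborel_singleton[of 0]
    proof eventually_elim
      case (elim s)
      then show ?case
        unfolding h_eq[OF elim] norm_scaleR norm_mult real_norm_def
        by (intro mult_left_le mult_le_one norm_E norm_\<phi> norm_ge_zero abs_ge_zero)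
    qed
  qed measurable
  have "(CLINT s|density lborel (exponential_density rate). \<phi> (u * exp (- s)) * exp (G (u * exp (- s)))) =
      (CLINT s|lborel. exponential_density rate s *\<^sub>R (\<phi> (u * exp (- s)) * E s))"
    unfolding E_def[symmetric] using rate_pos
    by (subst integral_density) (auto simp: exponential_density_nonneg)
  also have "\<dots> = (CLINT s|lborel. indicator {0<..} s *\<^sub>R h s)"
  proof (rule integral_cong_AE)
    show "AE s in lborel. exponential_density rate s *\<^sub>R (\<phi> (u * exp (- s)) * E s) = indicator {0<..} s *\<^sub>R h s"
      using AE_lborel_singleton[of 0] by eventually_elim (simp add: h_eq)
  qed measurable
  also have "\<dots> = (LBINT s=0..\<infinity>. h s)"
    by (simp add: interval_lebesgue_integral_def set_lebesgue_integral_def zero_ereal_def)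
  \<comment> \<open>The primitive is - \<open>exp (G u)\<close> at 0 and vanishes at infinity, since
    \<open>E\<close> stays bounded by 1 and the exponential decays.\<close>
  also have "\<dots> = 0 - (- exp (G u))"
  proof (rule interval_integral_FTC_integrable)
    show "((\<lambda>s. - of_real (exp (- s * rate)) * E s) has_vector_derivative h s) (at s)" for s
      by (rule deriv)
    show "isCont h s" for s by (rule cont_h)
    show "set_integrable lborel (einterval 0 \<infinity>) h"
      using int_h by (simp add: zero_ereal_def)
    have "isCont (\<lambda>s. - of_real (exp (- s * rate)) * E s) 0"
      by (intro continuous_intros cont_E)
    then have "((\<lambda>s. - of_real (exp (- s * rate)) * E s) \<longlongrightarrow> - exp (G u)) (at_right 0)"
      unfolding isCont_def E_def by (auto intro: tendsto_within_subset)
    then show "(((\<lambda>s. - of_real (exp (- s * rate)) * E s) \<circ> real_of_ereal) \<longlongrightarrow> - exp (G u)) (at_right 0)"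
      by (simp add: ereal_tendsto_simps zero_ereal_def)
    have "((\<lambda>s. - of_real (exp (- s * rate)) * E s) \<longlongrightarrow> 0) at_top"
    proof (rule Lim_null_comparison)
      show "eventually (\<lambda>s. norm (- of_real (exp (- s * rate)) * E s) \<le> exp (- s * rate)) at_top"
        using norm_E by (intro always_eventually) (auto simp: norm_mult intro!: mult_left_le)
      show "((\<lambda>s. exp (- s * rate)) \<longlongrightarrow> 0) at_top"
        using rate_pos by real_asymp
    qed
    then show "(((\<lambda>s. - of_real (exp (- s * rate)) * E s) \<circ> real_of_ereal) \<longlongrightarrow> 0) (at_left \<infinity>)"
      by (simp add: ereal_tendsto_simps)
  qed simp
  finally show ?thesis by simp
qed

text \<open>For the law of a constant, differentiation forces the exponent to be purely imaginary.
  Its real part is minus the integral of 1 - cos (u x), so cos (u x) = 1 for K-almost all x, which a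
  suitable u rules out.\<close>

lemma exp_G_nondegenerate: "\<exists>u. exp (G u) \<noteq> iexp (u * c)"
proof (rule ccontr)
  assume "\<not> ?thesis"
  then have eq: "exp (G u) = iexp (u * c)" for u by blast
  have Re0: "Re (cp_exponent K u) = 0" for u
  proof -
    \<comment> \<open>Differentiating along u * exp (- s) at s = 0 returns the exponent at u and
      avoids complex logarithms.\<close>
    have "((\<lambda>s. exp (G (u * exp (- s)))) has_vector_derivative
        - cp_exponent K (u * exp (- 0)) * exp (G (u * exp (- 0)))) (at 0)"
      using field_vector_diff_chain_at[OF has_vector_derivative_G_exp[of u 0] DERIV_exp] by (simp add: comp_def)
    moreover have "((\<lambda>s. iexp (u * exp (- s) * c)) has_vector_derivative
        - (u * c) *\<^sub>R (\<i> * iexp (u * c))) (at 0)"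
    proof -
      have "((\<lambda>s. u * exp (- s) * c) has_vector_derivative - (u * c)) (at 0)"
        by (auto intro!: derivative_eq_intros simp flip: has_real_derivative_iff_has_vector_derivative)
      from vector_diff_chain_at[OF this has_vector_derivative_iexp]
      show ?thesis by (simp add: comp_def)
    qed
    ultimately have "- cp_exponent K u * iexp (u * c) = - (u * c) *\<^sub>R (\<i> * iexp (u * c))"
      unfolding eq by (intro vector_derivative_unique_at) simp_all
    then have "cp_exponent K u = \<i> * of_real (u * c)"
      by (simp add: scaleR_conv_of_real)
    then show ?thesis by simp
  qed
  \<comment> \<open>With this u the numbers u * x are non-zero and at most 1 in modulus, where cos
    attains 1 only at 0.\<close>
  define u where "u = 1 / R"
  have int: "integrable K (\<lambda>x. iexp (u * x) - 1)"
    by (rule integrable_const_bound[where B = 2]) (auto intro!: order_trans[OF norm_triangle_ineq4])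
  have int': "integrable K (\<lambda>x. 1 - cos (u * x))"
    by (rule integrable_const_bound[where B = 2]) (auto intro!: order_trans[OF norm_triangle_ineq4] simp: abs_le_iff)
  have "(LINT x|K. 1 - cos (u * x)) = - Re (cp_exponent K u)"
    unfolding cp_exponent_def using int
    by (simp add: Re_exp flip: integral_Re Bochner_Integration.integral_minus)
  then have "(LINT x|K. 1 - cos (u * x)) = 0"
    using Re0 by simp
  then have "AE x in K. 1 - cos (u * x) = 0"
    using int' by (subst (asm) integral_nonneg_eq_0_iff_AE) auto
  with bounded_jumps have "AE x in K. False"
  proof eventually_elim
    case (elim x)
    then have "\<bar>u * x\<bar> \<le> 1" "u * x \<noteq> 0"
      using R_pos by (auto simp: u_def)
    moreover have "cos \<bar>u * x\<bar> = cos 0" using elim by simp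
    ultimately have "\<bar>u * x\<bar> = 0"
      using pi_gt3 by - (rule cos_inj_pi, auto)
    then show False using \<open>u * x \<noteq> 0\<close> by simp
  qed
  then have "measure K UNIV = 0"
    by (simp add: AE_iff_measurable[of UNIV] measure_def)
  then show False using rate_pos by simp
qed

end

section \<open>Levy processes\<close>

lemma levy_process_increment:
  assumes Y: "levy_process M Y" and "0 \<le> s" "0 \<le> h"
  shows "distr M borel (\<lambda>\<omega>. Y (s + h) \<omega> - Y s \<omega>) = distr M borel (Y h)"
proof -
  have meas: "\<And>t. 0 \<le> t \<Longrightarrow> Y t \<in> borel_measurable M" and Y0: "AE \<omega> in M. Y 0 \<omega> = 0"
    using Y unfolding levy_process_def by auto
  have "distr M borel (\<lambda>\<omega>. Y (s + h) \<omega> - Y s \<omega>) = distr M borel (\<lambda>\<omega>. Y h \<omega> - Y 0 \<omega>)"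
    using assms unfolding levy_process_def by blast
  also have "\<dots> = distr M borel (Y h)"
    using Y0 meas[OF \<open>0 \<le> h\<close>] meas[of 0]
    by (intro distr_cong_AE) (auto elim!: eventually_mono)
  finally show ?thesis .
qed

definition riemann_sum :: "(real \<Rightarrow> 'a \<Rightarrow> real) \<Rightarrow> real \<Rightarrow> nat \<Rightarrow> 'a \<Rightarrow> real" where
  "riemann_sum Y t n \<omega> =
    (\<Sum>j<Suc n. exp (- grid t n (Suc j)) * (Y (grid t n (Suc j)) \<omega> - Y (grid t n j) \<omega>))"

lemma riemann_sum_measurable:
  assumes "levy_process M Y" "0 \<le> t"
  shows "riemann_sum Y t n \<in> borel_measurable M"
proof -
  have [measurable]: "Y (grid t n j) \<in> borel_measurable M" for j
    using assms grid_nonneg[of t n j] unfolding levy_process_def by auto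
  show ?thesis unfolding riemann_sum_def[abs_def] by measurable
qed

text \<open>All cells have the same length, so the independent increments share the law of
  \<open>Y\<close> at the mesh; the deterministic weights only rescale the frequency.\<close>

lemma char_riemann_sum:
  assumes Y: "levy_process M Y" and t: "0 \<le> t"
  shows "char (distr M borel (riemann_sum Y t n)) u =
    (\<Prod>j<Suc n. char (distr M borel (Y (t / real (Suc n)))) (u * exp (- grid t n (Suc j))))"
proof -
  interpret prob_space M using Y unfolding levy_process_def by auto
  have [measurable]: "Y (grid t n j) \<in> borel_measurable M" for j
    using Y grid_nonneg[OF t, of n j] unfolding levy_process_def by auto
  define X where "X j \<omega> = Y (grid t n (Suc j)) \<omega> - Y (grid t n j) \<omega>" for j \<omega>
  have [measurable]: "X j \<in> borel_measurable M" for j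
    unfolding X_def[abs_def] by measurable
  have "indep_vars (\<lambda>_. borel) X {..<Suc n}"
  proof -
    have "\<forall>(m::nat) s. 0 \<le> s 0 \<and> (\<forall>i<m. s i \<le> s (Suc i)) \<longrightarrow>
        indep_vars (\<lambda>_. borel) (\<lambda>i \<omega>. Y (s (Suc i)) \<omega> - Y (s i) \<omega>) {..<m}"
      using Y unfolding levy_process_def by auto
    from this[rule_format, of "grid t n" "Suc n"] show ?thesis
      unfolding X_def[abs_def] using grid_mono[OF t] by auto
  qed
  then have "indep_vars (\<lambda>_. borel) (\<lambda>j \<omega>. exp (- grid t n (Suc j)) * X j \<omega>) {..<Suc n}"
    by (rule indep_vars_compose2) measurable
  from char_distr_sum[OF this, of u]
  have "char (distr M borel (riemann_sum Y t n)) u =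
      (\<Prod>j<Suc n. char (distr M borel (\<lambda>\<omega>. exp (- grid t n (Suc j)) * X j \<omega>)) u)"
    unfolding riemann_sum_def[abs_def] X_def by simp
  also have "\<dots> = (\<Prod>j<Suc n. char (distr M borel (Y (t / real (Suc n)))) (u * exp (- grid t n (Suc j))))"
  proof (rule prod.cong[OF refl])
    fix j
    have "distr M borel (X j) = distr M borel (Y (t / real (Suc n)))"
      unfolding X_def[abs_def] grid_Suc using t
      by (intro levy_process_increment[OF Y] grid_nonneg) auto
    moreover have "char (distr M borel (\<lambda>\<omega>. exp (- grid t n (Suc j)) * X j \<omega>)) u =
        char (distr M borel (X j)) (u * exp (- grid t n (Suc j)))"
      unfolding char_def by (simp add: integral_distr mult.assoc)
    ultimately show "char (distr M borel (\<lambda>\<omega>. exp (- grid t n (Suc j)) * X j \<omega>)) u =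
        char (distr M borel (Y (t / real (Suc n)))) (u * exp (- grid t n (Suc j)))"
      by simp
  qed
  finally show ?thesis .
qed

lemma riemann_sum_tendsto:
  assumes Y: "levy_process M Y"
  shows "AE \<omega> in M. \<forall>t>0. (\<lambda>n. riemann_sum Y t n \<omega>) \<longlonglongrightarrow> exp_integral Y t \<omega>"
proof -
  have "AE \<omega> in M. cadlag (\<lambda>t. Y t \<omega>)" "AE \<omega> in M. Y 0 \<omega> = 0"
    using Y unfolding levy_process_def by auto
  then show ?thesis
    by eventually_elim (use exp_integral_riemann_sums in \<open>auto simp: riemann_sum_def\<close>)
qed

lemma char_tendsto_AE:
  assumes M: "prob_space M" and [measurable]: "\<And>n. X n \<in> borel_measurable M" "Z \<in> borel_measurable M"
    and lim: "AE \<omega> in M. (\<lambda>n. X n \<omega>) \<longlonglongrightarrow> (Z \<omega> :: real)"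
  shows "(\<lambda>n. char (distr M borel (X n)) u) \<longlonglongrightarrow> char (distr M borel Z) u"
proof -
  interpret prob_space M by fact
  have "(\<lambda>n. CLINT \<omega>|M. iexp (u * X n \<omega>)) \<longlonglongrightarrow> (CLINT \<omega>|M. iexp (u * Z \<omega>))"
  proof (rule integral_dominated_convergence[where w = "\<lambda>_. 1"])
    show "AE \<omega> in M. (\<lambda>n. iexp (u * X n \<omega>)) \<longlonglongrightarrow> iexp (u * Z \<omega>)"
      using lim by eventually_elim (intro tendsto_intros)
  qed auto
  then show ?thesis
    unfolding char_def by (simp add: integral_distr)
qed

lemma char_independent_processes:
  assumes M: "prob_space M" and indep: "independent_processes M X Y" and t: "0 \<le> t"
  shows "char (distr M borel (\<lambda>\<omega>. X t \<omega> + Y t \<omega>)) u = char (distr M borel (X t)) u * char (distr M borel (Y t)) u"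
proof -
  interpret prob_space M by fact
  have "indep_var borel ((\<lambda>f. f t) \<circ> (\<lambda>\<omega>. \<lambda>t\<in>{0..}. X t \<omega>)) borel ((\<lambda>f. f t) \<circ> (\<lambda>\<omega>. \<lambda>t\<in>{0..}. Y t \<omega>))"
    using indep t unfolding independent_processes_def
    by (intro indep_var_compose[where ?M1.0 = "PiM {0..} (\<lambda>_. borel)" and ?M2.0 = "PiM {0..} (\<lambda>_. borel)"]) auto
  then have "indep_var borel (X t) borel (Y t)"
    using t by (simp add: comp_def)
  then show ?thesis by (rule char_distr_add)
qed

section \<open>Splitting off a bounded compound Poisson part\<close>

lemma levy_measure_jumps_pos:
  assumes L: "levy_measure L" and nz: "\<not> (AE x in L. False)"
  obtains N where "0 < measure (restricted L (jumps N)) UNIV"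
proof (rule ccontr)
  assume "\<not> thesis"
  then have zero: "measure (restricted L (jumps N)) UNIV = 0" for N
    using that zero_less_measure_iff by blast
  have sets_L [measurable_cong]: "sets L = sets borel"
    using L unfolding levy_measure_def by auto
  have space_L: "space L = UNIV"
    using sets_eq_imp_space_eq[OF sets_L] by simp
  have "emeasure L (jumps N) = 0" for N
  proof -
    interpret finite_measure "restricted L (jumps N)"
      by (rule finite_measure_restricted_jumps[OF L])
    have "emeasure (restricted L (jumps N)) UNIV = emeasure L (jumps N)"
      unfolding restricted_def by (subst emeasure_density) (auto simp: sets_L space_L)
    then show ?thesis
      using zero[of N] by (simp add: emeasure_eq_measure)
  qed
  then have "AE x in L. x \<notin> jumps N" for N
    by (intro AE_I[where N = "jumps N"]) (auto simp: sets_L)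
  \<comment> \<open>The countably many annuli cover everything except 0, which carries no mass
    either.\<close>
  then have "AE x in L. \<forall>N. x \<notin> jumps N"
    by (simp add: AE_all_countable)
  moreover have "AE x in L. x \<noteq> 0"
    by (rule AE_I[where N = "{0}"]) (use L in \<open>auto simp: levy_measure_def\<close>)
  ultimately have "AE x in L. False"
  proof eventually_elim
    case (elim x)
    then show False
      using eventually_in_jumps[of x] by (auto simp: eventually_sequentially)
  qed
  then show False using nz by simp
qed

lemma bounded_jump_measure_restricted:
  assumes L: "levy_measure L" and pos: "0 < measure (restricted L (jumps N)) UNIV"
  shows "bounded_jump_measure (restricted L (jumps N)) (real (Suc N))"
proof (rule bounded_jump_measure.intro)
  have sets_L [measurable_cong]: "sets L = sets borel"
    using L unfolding levy_measure_def by auto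
  show "finite_measure (restricted L (jumps N))"
    by (rule finite_measure_restricted_jumps[OF L])
  show "sets (restricted L (jumps N)) = sets borel" by (simp add: sets_L)
  have "0 < 1 / real (Suc N)" by simp
  then have "x \<noteq> 0 \<and> \<bar>x\<bar> \<le> real (Suc N)" if "x \<in> jumps N" for x
    using that unfolding jumps_def by (auto simp del: of_nat_Suc)
  then show "AE x in restricted L (jumps N). x \<noteq> 0 \<and> \<bar>x\<bar> \<le> real (Suc N)"
    unfolding restricted_def by (subst AE_density) (auto simp: sets_L split: split_indicator)
qed (use pos in auto)

text \<open>The exponent is additive in the Levy measure: the mass on one annulus gives the compound
  Poisson factor, the rest and the drift from removing the centering form g. The same annulus serves
  for every h.\<close>

lemma purely_discontinuous_split:
  assumes Yd: "purely_discontinuous M Yd" and nz: "nonzero_process M Yd"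
  obtains K R where "bounded_jump_measure K R"
    "\<And>h. 0 \<le> h \<Longrightarrow> \<exists>g. characteristic_function g \<and>
      (\<forall>u. char (distr M borel (Yd h)) u = g u * exp (of_real h * cp_exponent K u))"
proof -
  have "levy_process M Yd" using Yd unfolding purely_discontinuous_def by auto
  then interpret prob_space M unfolding levy_process_def by auto
  have Yd_meas [measurable]: "Yd t \<in> borel_measurable M" if "0 \<le> t" for t
    using \<open>levy_process M Yd\<close> that unfolding levy_process_def by auto
  obtain L where L: "levy_measure L"
    and char_Yd: "\<And>t u. 0 \<le> t \<Longrightarrow> char (distr M borel (Yd t)) u = exp (of_real t * (CLINT x|L. lk_integrand u x))"
    using Yd unfolding purely_discontinuous_def lk_integrand_def by blast
  have sets_L [measurable_cong]: "sets L = sets borel"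
    using L unfolding levy_measure_def by auto
  \<comment> \<open>Without jumps the exponent vanishes and every \<open>Yd t\<close> would be 0
    almost surely.\<close>
  have "\<not> (AE x in L. False)"
  proof
    assume "AE x in L. False"
    then have "(CLINT x|L. lk_integrand u x) = 0" for u
      by (intro integral_eq_zero_AE) (auto elim: eventually_mono)
    then have char_1: "char (distr M borel (Yd t)) = char (return borel 0)" if "0 \<le> t" for t
      using that char_Yd by (auto simp: char_def integral_return)
    have "AE \<omega> in M. Yd t \<omega> = 0" if "0 \<le> t" for t
    proof -
      have eq: "distr M borel (Yd t) = return borel 0"
        by (rule Levy_uniqueness[OF _ _ char_1[OF that]])
           (use that in \<open>auto intro!: real_distribution.intro prob_space_return real_distribution_axioms.intro\<close>)
      have "AE x in distr M borel (Yd t). x = 0"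
        unfolding eq by (subst AE_return) auto
      then show ?thesis using that by (subst (asm) AE_distr_iff) auto
    qed
    then show False using nz unfolding nonzero_process_def by auto
  qed
  from levy_measure_jumps_pos[OF L this] obtain N where N: "0 < measure (restricted L (jumps N)) UNIV" .
  define K where "K = restricted L (jumps N)"
  define L' where "L' = restricted L (- jumps N)"
  have L': "levy_measure L'"
    unfolding L'_def by (rule levy_measure_restricted[OF L]) auto
  obtain b where b: "\<And>u. (CLINT x|K. lk_integrand u x) = cp_exponent K u - \<i> * of_real (u * b)"
    using lk_exponent_restricted_jumps[OF L, of N] unfolding K_def cp_exponent_def by blast
  have split: "(CLINT x|L. lk_integrand u x) = (CLINT x|L'. lk_integrand u x) + (CLINT x|K. lk_integrand u x)" for u
  proof -
    have ind: "integrable L (\<lambda>x. indicator E x *\<^sub>R lk_integrand u x)" if "E \<in> sets borel" for E :: "real set"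
      using levy_measure_integrable(2)[OF L, of u] that by (intro integrable_mult_indicator) (auto simp: sets_L)
    have "(CLINT x|L'. lk_integrand u x) + (CLINT x|K. lk_integrand u x) =
        (CLINT x|L. indicator (- jumps N) x *\<^sub>R lk_integrand u x + indicator (jumps N) x *\<^sub>R lk_integrand u x)"
      unfolding L'_def K_def
      by (subst Bochner_Integration.integral_add) (auto intro!: ind simp: restricted_integral sets_L)
    also have "\<dots> = (CLINT x|L. lk_integrand u x)"
      by (intro Bochner_Integration.integral_cong) (auto split: split_indicator)
    finally show ?thesis ..
  qed
  show ?thesis
  proof
    show "bounded_jump_measure K (real (Suc N))"
      unfolding K_def by (rule bounded_jump_measure_restricted[OF L N])
    fix h :: real assume h: "0 \<le> h"
    \<comment> \<open>The shift - h * b undoes the centering of the jumps that were moved into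
      K.\<close>
    define g where "g u = exp (of_real h * (CLINT x|L'. lk_integrand u x)) * iexp (u * (- h * b))" for u
    have "characteristic_function g"
      unfolding g_def
      by (intro characteristic_function_mult characteristic_function_levy_khintchine L' h characteristic_function_iexp)
    moreover have "char (distr M borel (Yd h)) u = g u * exp (of_real h * cp_exponent K u)" for u
      unfolding char_Yd[OF h] split b g_def exp_add[symmetric]
      by (rule arg_cong[where f = exp]) (simp add: algebra_simps)
    ultimately show "\<exists>g. characteristic_function g \<and>
        (\<forall>u. char (distr M borel (Yd h)) u = g u * exp (of_real h * cp_exponent K u))"
      by blast
  qed
qed

text \<open>At every grid the compound Poisson factor is cancelled increment by increment, which
  leaves a product of characteristic functions; only then are the mesh and the time horizon sent to
  their limits. Continuity of \<open>G\<close> makes both limit functions continuous at 0.\<close>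

lemma (in bounded_jump_measure) levy_factor:
  fixes M :: "'a measure"
  assumes bdlp: "background_driving_levy_process M Y \<mu>"
    and factor: "\<And>h. 0 \<le> h \<Longrightarrow> \<exists>g. characteristic_function g \<and>
      (\<forall>u. char (distr M borel (Y h)) u = g u * exp (of_real h * cp_exponent K u))"
  shows "characteristic_function (\<lambda>u. char \<mu> u * exp (- G u))"
proof -
  have Y: "levy_process M Y"
    using bdlp unfolding background_driving_levy_process_def by auto
  then interpret P: prob_space M unfolding levy_process_def by auto
  obtain I where [measurable]: "I \<in> borel_measurable M"
    and I: "AE \<omega> in M. ((\<lambda>t. exp_integral Y t \<omega>) \<longlongrightarrow> I \<omega>) at_top" and \<mu>: "distr M borel I = \<mu>"
    using bdlp unfolding background_driving_levy_process_def by auto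
  have [measurable]: "riemann_sum Y (real (Suc m)) n \<in> borel_measurable M" for m n
    by (rule riemann_sum_measurable[OF Y]) simp
  \<comment> \<open>\<open>exp_integral\<close> is defined path by path; as a limit of Riemann sums
    \<open>J\<close> is measurable for free, and it agrees with the integral almost surely.\<close>
  define J where "J m \<omega> = lim (\<lambda>n. riemann_sum Y (real (Suc m)) n \<omega>)" for m \<omega>
  have [measurable]: "J m \<in> borel_measurable M" for m
    unfolding J_def[abs_def] by (rule borel_measurable_lim_metric) measurable
  have J: "AE \<omega> in M. \<forall>m. (\<lambda>n. riemann_sum Y (real (Suc m)) n \<omega>) \<longlonglongrightarrow> J m \<omega> \<and>
      J m \<omega> = exp_integral Y (real (Suc m)) \<omega>"
    using riemann_sum_tendsto[OF Y]
  proof eventually_elim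
    case (elim \<omega>)
    then have "(\<lambda>n. riemann_sum Y (real (Suc m)) n \<omega>) \<longlonglongrightarrow> exp_integral Y (real (Suc m)) \<omega>" for m
      by (simp del: of_nat_Suc)
    then show ?case
      unfolding J_def using limI by metis
  qed
  show ?thesis
  proof (rule characteristic_function_limit)
    fix m
    define t where "t = real (Suc m)"
    have t: "0 < t" by (simp add: t_def)
    define h where "h n = t / real (Suc n)" for n
    have "\<forall>n. \<exists>g. characteristic_function g \<and>
        (\<forall>u. char (distr M borel (Y (h n))) u = g u * exp (of_real (h n) * cp_exponent K u))"
      using t unfolding h_def by (intro allI factor) simp
    then obtain g where g: "\<And>n. characteristic_function (g n)"
      and char_Y: "\<And>n u. char (distr M borel (Y (h n))) u = g n u * exp (of_real (h n) * cp_exponent K u)"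
      by metis
    show "characteristic_function (\<lambda>u. char (distr M borel (J m)) u * exp (- (G u - G (u * exp (- real (Suc m))))))"
      unfolding t_def[symmetric]
    proof (rule characteristic_function_limit)
      show "characteristic_function (\<lambda>u. \<Prod>j<Suc n. g n (u * exp (- grid t n (Suc j))))" for n
        by (intro characteristic_function_prod characteristic_function_scale g)
      have "isCont (\<lambda>u. G (u * exp (- t))) 0"
        by (rule isCont_o2[OF _ isCont_G]) (intro continuous_intros)
      then show "isCont (\<lambda>u. char (distr M borel (J m)) u * exp (- (G u - G (u * exp (- t))))) 0"
        by (intro continuous_intros isCont_G real_distribution.isCont_char) auto
      fix u
      define E where "E n = (\<Sum>j<Suc n. of_real (h n) * cp_exponent K (u * exp (- grid t n (Suc j))))" for n
      have "(\<lambda>n. char (distr M borel (riemann_sum Y t n)) u) \<longlonglongrightarrow> char (distr M borel (J m)) u"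
        unfolding t_def using J
        by (intro char_tendsto_AE P.prob_space_axioms riemann_sum_measurable[OF Y]) (auto elim!: eventually_mono)
      moreover have "E \<longlonglongrightarrow> G u - G (u * exp (- t))"
        unfolding E_def h_def by (rule exponent_riemann_sums[OF t])
      ultimately have "(\<lambda>n. char (distr M borel (riemann_sum Y t n)) u * exp (- E n)) \<longlonglongrightarrow>
          char (distr M borel (J m)) u * exp (- (G u - G (u * exp (- t))))"
        by (intro tendsto_intros)
      moreover have "char (distr M borel (riemann_sum Y t n)) u * exp (- E n) =
          (\<Prod>j<Suc n. g n (u * exp (- grid t n (Suc j))))" for n
      proof -
        \<comment> \<open>The factors removed from the individual increments multiply to exp of the
          Riemann sum \<open>E n\<close>, so dividing by it leaves exactly the product of the
          \<open>g n\<close>.\<close>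
        have "char (distr M borel (riemann_sum Y t n)) u =
            (\<Prod>j<Suc n. g n (u * exp (- grid t n (Suc j)))) * exp (E n)"
          using t unfolding E_def exp_sum[OF finite_lessThan] prod.distrib[symmetric]
          by (subst char_riemann_sum[OF Y]) (simp_all only: char_Y h_def[symmetric] less_imp_le)
        then show ?thesis by (simp add: exp_minus del: prod.lessThan_Suc)
      qed
      ultimately show "(\<lambda>n. \<Prod>j<Suc n. g n (u * exp (- grid t n (Suc j)))) \<longlonglongrightarrow>
          char (distr M borel (J m)) u * exp (- (G u - G (u * exp (- t))))"
        by (simp del: prod.lessThan_Suc)
    qed
  next
    fix u
    have "AE \<omega> in M. (\<lambda>m. J m \<omega>) \<longlonglongrightarrow> I \<omega>"
      using I J
    proof eventually_elim
      case (elim \<omega>)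
      have "filterlim (\<lambda>m. real (Suc m)) at_top sequentially"
        by (rule filterlim_compose[OF filterlim_real_sequentially filterlim_Suc])
      from filterlim_compose[OF elim(1) this] show ?case
        using elim(2) by simp
    qed
    then have "(\<lambda>m. char (distr M borel (J m)) u) \<longlonglongrightarrow> char \<mu> u"
      unfolding \<mu>[symmetric] by (intro char_tendsto_AE P.prob_space_axioms) auto
    then show "(\<lambda>m. char (distr M borel (J m)) u * exp (- (G u - G (u * exp (- real (Suc m)))))) \<longlonglongrightarrow>
        char \<mu> u * exp (- G u)"
      using tendsto_mult[OF _ tendsto_exp[OF tendsto_minus[OF tendsto_diff[OF tendsto_const[of "G u"] G_scaled_tendsto_0]]]]
      by simp
  next
    have "real_distribution \<mu>" unfolding \<mu>[symmetric] by (rule P.real_distribution_distr) measurable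
    then show "isCont (\<lambda>u. char \<mu> u * exp (- G u)) 0"
      by (intro continuous_intros isCont_G real_distribution.isCont_char)
  qed
qed

section \<open>An independent triple and the random equation of the factor\<close>

lemma real_distribution_triple:
  fixes \<alpha> \<kappa> \<nu> :: "real measure"
  assumes "real_distribution \<alpha>" "real_distribution \<kappa>" "real_distribution \<nu>"
  defines "P \<equiv> \<alpha> \<Otimes>\<^sub>M (\<kappa> \<Otimes>\<^sub>M \<nu>)"
  shows "prob_space P"
    and "distr P borel fst = \<alpha>" and "distr P borel (\<lambda>\<omega>. snd (snd \<omega>)) = \<nu>"
    and "prob_space.indep_vars P (\<lambda>_. borel) (\<lambda>i::nat. [fst, \<lambda>\<omega>. fst (snd \<omega>), \<lambda>\<omega>. snd (snd \<omega>)] ! i) {..<3}"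
    and "char (distr P borel (\<lambda>\<omega>. fst \<omega> * (snd (snd \<omega>) + fst (snd \<omega>)))) u =
      (CLINT a|\<alpha>. char \<kappa> (u * a) * char \<nu> (u * a))"
proof -
  interpret \<alpha>: real_distribution \<alpha> by fact
  interpret \<kappa>: real_distribution \<kappa> by fact
  interpret \<nu>: real_distribution \<nu> by fact
  interpret KN: pair_prob_space \<kappa> \<nu> ..
  interpret P: pair_prob_space \<alpha> "\<kappa> \<Otimes>\<^sub>M \<nu>" ..
  have sets_P [measurable_cong]: "sets P = sets (borel \<Otimes>\<^sub>M (borel \<Otimes>\<^sub>M borel))"
    unfolding P_def by (intro sets_pair_measure_cong) auto
  have space_P: "space P = UNIV"
    using sets_eq_imp_space_eq[OF sets_P] by (simp add: space_pair_measure)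
  show "prob_space P" unfolding P_def by (rule P.prob_space_axioms)
  then interpret PP: prob_space P .
  have times: "emeasure P (A \<times> (B \<times> C)) = emeasure \<alpha> A * (emeasure \<kappa> B * emeasure \<nu> C)"
    if "A \<in> sets borel" "B \<in> sets borel" "C \<in> sets borel" for A B C :: "real set"
    unfolding P_def using that
    by (subst sigma_finite_measure.emeasure_pair_measure_Times[OF KN.sigma_finite_measure_axioms]) (auto simp: \<nu>.emeasure_pair_measure_Times)
  have total: "emeasure \<alpha> UNIV = 1" "emeasure \<kappa> UNIV = 1" "emeasure \<nu> UNIV = 1"
    using \<alpha>.emeasure_space_1 \<kappa>.emeasure_space_1 \<nu>.emeasure_space_1 by simp_all
  show "distr P borel fst = \<alpha>"
  proof (rule measure_eqI)
    fix A assume "A \<in> sets (distr P borel fst)"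
    then have A: "A \<in> sets borel" by simp
    have "fst -` A \<inter> space P = A \<times> (UNIV \<times> UNIV)" by (auto simp: space_P)
    then show "emeasure (distr P borel fst) A = emeasure \<alpha> A"
      using A times[OF A, of UNIV UNIV] total by (subst emeasure_distr) auto
  qed simp
  show "distr P borel (\<lambda>\<omega>. snd (snd \<omega>)) = \<nu>"
  proof (rule measure_eqI)
    fix A assume "A \<in> sets (distr P borel (\<lambda>\<omega>. snd (snd \<omega>)))"
    then have A: "A \<in> sets borel" by simp
    have "(\<lambda>\<omega>. snd (snd \<omega>)) -` A \<inter> space P = UNIV \<times> (UNIV \<times> A)" by (auto simp: space_P)
    then show "emeasure (distr P borel (\<lambda>\<omega>. snd (snd \<omega>))) A = emeasure \<nu> A"
      using A times[of UNIV UNIV A] total by (subst emeasure_distr) auto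
  qed simp
  define X :: "nat \<Rightarrow> real \<times> real \<times> real \<Rightarrow> real" where "X i = [fst, \<lambda>\<omega>. fst (snd \<omega>), \<lambda>\<omega>. snd (snd \<omega>)] ! i" for i
  have X: "X 0 = fst" "X (Suc 0) = (\<lambda>\<omega>. fst (snd \<omega>))" "X 1 = (\<lambda>\<omega>. fst (snd \<omega>))" "X 2 = (\<lambda>\<omega>. snd (snd \<omega>))"
    by (auto simp: X_def)
  have three: "{..<3} = {0, 1, 2 :: nat}" by auto
  have "PP.indep_vars (\<lambda>_. borel) X {..<3}"
  proof (subst PP.indep_vars_finite[where E = "\<lambda>_. sets borel"])
    show "PP.random_variable borel (X i)" if "i \<in> {..<3}" for i
      using that X unfolding three by auto
    show "\<forall>A\<in>(\<Pi> i\<in>{..<3}. sets borel). PP.prob (\<Inter>j\<in>{..<3}. X j -` A j \<inter> space P) =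
        (\<Prod>j\<in>{..<3}. PP.prob (X j -` A j \<inter> space P))"
    proof
      fix A assume "A \<in> (\<Pi> i\<in>{..<3::nat}. sets (borel :: real measure))"
      then have A: "A 0 \<in> sets borel" "A 1 \<in> sets borel" "A 2 \<in> sets borel" by auto
      have m: "PP.prob (B \<times> (C \<times> D)) = measure \<alpha> B * (measure \<kappa> C * measure \<nu> D)"
        if "B \<in> sets borel" "C \<in> sets borel" "D \<in> sets borel" for B C D
        using times[OF that] by (simp add: measure_def enn2real_mult)
      have one: "measure \<alpha> UNIV = 1" "measure \<kappa> UNIV = 1" "measure \<nu> UNIV = 1"
        using total by (simp_all add: measure_def)
      have m1: "PP.prob (B \<times> UNIV) = measure \<alpha> B" if "B \<in> sets borel" for B
        using m[OF that, of UNIV UNIV] one by simp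
      have "(\<Inter>j\<in>{..<3}. X j -` A j \<inter> space P) = A 0 \<times> (A 1 \<times> A 2)"
        unfolding three by (auto simp: X space_P)
      moreover have "X 0 -` A 0 \<inter> space P = A 0 \<times> (UNIV \<times> UNIV)"
        "X 1 -` A 1 \<inter> space P = UNIV \<times> (A 1 \<times> UNIV)" "X 2 -` A 2 \<inter> space P = UNIV \<times> (UNIV \<times> A 2)"
        by (auto simp: X space_P)
      ultimately show "PP.prob (\<Inter>j\<in>{..<3}. X j -` A j \<inter> space P) =
          (\<Prod>j\<in>{..<3}. PP.prob (X j -` A j \<inter> space P))"
        using A unfolding three by (simp add: m m1 one)
    qed
  qed (auto simp: Int_stable_def sets.sigma_sets_eq[of borel, simplified] three)
  then show "PP.indep_vars (\<lambda>_. borel) (\<lambda>i::nat. [fst, \<lambda>\<omega>. fst (snd \<omega>), \<lambda>\<omega>. snd (snd \<omega>)] ! i) {..<3}"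
    unfolding X_def[abs_def] .
  \<comment> \<open>Given the value a of the multiplier, both summands are seen at the frequency u *
    a, and they are independent.\<close>
  have "char (distr P borel (\<lambda>\<omega>. fst \<omega> * (snd (snd \<omega>) + fst (snd \<omega>)))) u =
      (CLINT \<omega>|P. iexp (u * fst \<omega> * fst (snd \<omega>)) * iexp (u * fst \<omega> * snd (snd \<omega>)))"
    unfolding char_def by (subst integral_distr) (auto simp: exp_add[symmetric] algebra_simps)
  also have "\<dots> = (CLINT a|\<alpha>. CLINT y|\<kappa> \<Otimes>\<^sub>M \<nu>. iexp (u * a * fst y) * iexp (u * a * snd y))"
    unfolding P_def
    by (subst P.integral_fst'[symmetric]) (auto intro!: P.integrable_const_bound[where B = 1] simp: norm_mult)
  also have "\<dots> = (CLINT a|\<alpha>. CLINT c|\<kappa>. CLINT z|\<nu>. iexp (u * a * c) * iexp (u * a * z))"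
    by (subst KN.integral_fst'[symmetric]) (auto intro!: KN.integrable_const_bound[where B = 1] simp: norm_mult)
  also have "\<dots> = (CLINT a|\<alpha>. char \<kappa> (u * a) * char \<nu> (u * a))"
    unfolding char_def by simp
  finally show "char (distr P borel (\<lambda>\<omega>. fst \<omega> * (snd (snd \<omega>) + fst (snd \<omega>)))) u =
      (CLINT a|\<alpha>. char \<kappa> (u * a) * char \<nu> (u * a))" .
qed

text \<open>Here \<open>\<alpha>\<close> is the law of the discount factor at the first jump and
  \<open>\<kappa>\<close> the law of that jump. Under their product with \<open>\<nu>\<close>, the
  characteristic function of A * (Z + C) is the integral in
  \<open>exp_G_fixed_point\<close>.\<close>

lemma (in bounded_jump_measure) compound_poisson_factor:
  assumes \<nu>: "real_distribution \<nu>" "char \<nu> = (\<lambda>u. exp (G u))"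
  shows "\<exists>(P :: (real \<times> real \<times> real) measure) A C Z.
    prob_space P \<and>
    prob_space.indep_vars P (\<lambda>_. borel) (\<lambda>i::nat. [A, C, Z] ! i) {..<3} \<and>
    distr P borel Z = \<nu> \<and>
    distr P borel (\<lambda>\<omega>. A \<omega> * (Z \<omega> + C \<omega>)) = \<nu> \<and>
    (AE \<omega> in P. 0 \<le> A \<omega> \<and> A \<omega> \<le> 1) \<and>
    nontrivial_multiplier P A"
proof -
  let ?D = "density lborel (exponential_density rate)"
  define \<alpha> where "\<alpha> = distr ?D borel (\<lambda>s. exp (- s))"
  interpret D: prob_space ?D by (rule prob_space_exponential_density[OF rate_pos])
  have \<alpha>: "real_distribution \<alpha>"
    unfolding \<alpha>_def by (rule D.real_distribution_distr) measurable
  obtain \<kappa> where \<kappa>: "real_distribution \<kappa>" "\<And>u. cp_exponent K u = of_real rate * (char \<kappa> u - 1)"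
    using exponent_normalised unfolding characteristic_function_def by blast
  define P where "P = \<alpha> \<Otimes>\<^sub>M (\<kappa> \<Otimes>\<^sub>M \<nu>)"
  note triple = real_distribution_triple[OF \<alpha> \<kappa>(1) \<nu>(1), folded P_def]
  interpret P: prob_space P by (rule triple(1))
  have sets_P [measurable_cong]: "sets P = sets (borel \<Otimes>\<^sub>M (borel \<Otimes>\<^sub>M borel))"
    unfolding P_def using \<alpha> \<kappa> \<nu>
    by (intro sets_pair_measure_cong) (auto simp: real_distribution.events_eq_borel)
  have AE_D: "AE s in ?D. Q s" if "\<And>s. 0 \<le> s \<Longrightarrow> Q s" for Q
    using that by (subst AE_density) (auto simp: exponential_density_def ennreal_eq_0_iff)
  have AE_A: "(AE \<omega> in P. Q (fst \<omega>)) \<longleftrightarrow> (AE s in ?D. Q (exp (- s)))"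
    if [measurable]: "Measurable.pred borel Q" for Q
  proof -
    have "(AE \<omega> in P. Q (fst \<omega>)) \<longleftrightarrow> (AE a in distr P borel fst. Q a)"
      by (rule AE_distr_iff[symmetric]) measurable
    also have "\<dots> \<longleftrightarrow> (AE s in ?D. Q (exp (- s)))"
      unfolding triple(2) \<alpha>_def by (rule AE_distr_iff) measurable
    finally show ?thesis .
  qed
  \<comment> \<open>Either kind of triviality of exp (- s) would pin the waiting time to a single
    value: - ln c for a constant c, or 0 for the values 0 and 1.\<close>
  have no_atom: "\<not> (AE s in ?D. s = c)" for c
  proof
    assume "AE s in ?D. s = c"
    moreover have "AE s in ?D. s \<noteq> c"
      using AE_lborel_singleton[of c] by (subst AE_density) auto
    ultimately have "AE s in ?D. False" by eventually_elim auto
    then show False by simp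
  qed
  have "distr P borel (\<lambda>\<omega>. fst \<omega> * (snd (snd \<omega>) + fst (snd \<omega>))) = \<nu>"
  proof (rule Levy_uniqueness)
    show "real_distribution (distr P borel (\<lambda>\<omega>. fst \<omega> * (snd (snd \<omega>) + fst (snd \<omega>))))"
      by (rule P.real_distribution_distr) measurable
    have [measurable]: "char \<kappa> \<in> borel_measurable borel" "(\<lambda>u. exp (G u)) \<in> borel_measurable borel"
      using real_distribution.char_measurable[OF \<kappa>(1)] real_distribution.char_measurable[OF \<nu>(1)] \<nu>(2) by auto
    show "char (distr P borel (\<lambda>\<omega>. fst \<omega> * (snd (snd \<omega>) + fst (snd \<omega>)))) = char \<nu>"
    proof
      fix u
      have "(CLINT a|\<alpha>. char \<kappa> (u * a) * char \<nu> (u * a)) =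
          (CLINT s|?D. char \<kappa> (u * exp (- s)) * exp (G (u * exp (- s))))"
        unfolding \<alpha>_def \<nu>(2) by (subst integral_distr) auto
      also have "\<dots> = exp (G u)"
        using \<kappa> by (intro exp_G_fixed_point) auto
      finally show "char (distr P borel (\<lambda>\<omega>. fst \<omega> * (snd (snd \<omega>) + fst (snd \<omega>)))) u = char \<nu> u"
        unfolding triple(5) \<nu>(2) .
    qed
  qed (rule \<nu>(1))
  moreover have "AE \<omega> in P. 0 \<le> fst \<omega> \<and> fst \<omega> \<le> 1"
    by (subst AE_A) (auto intro: AE_D)
  moreover have "nontrivial_multiplier P fst"
    unfolding nontrivial_multiplier_def
  proof safe
    fix c assume "AE \<omega> in P. fst \<omega> = c"
    then have "AE s in ?D. exp (- s) = c" by (subst (asm) AE_A) auto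
    then have "AE s in ?D. s = - ln c" by eventually_elim auto
    then show False using no_atom by blast
  next
    assume "AE \<omega> in P. fst \<omega> \<in> {0, 1}"
    then have "AE s in ?D. exp (- s) \<in> {0, 1}" by (subst (asm) AE_A) auto
    then have "AE s in ?D. s = 0" by eventually_elim auto
    then show False using no_atom by blast
  qed
  ultimately show ?thesis
    using triple(1,3,4)
    by (intro exI[of _ P] exI[of _ fst] exI[of _ "\<lambda>\<omega>. fst (snd \<omega>)"] exI[of _ "\<lambda>\<omega>. snd (snd \<omega>)"] conjI)
qed

text \<open>By independence, \<open>Yc\<close> multiplies the characteristic function of each
  increment, so it joins the remaining factor g. Uniqueness then turns char \<mu> = exp G * (char
  \<mu> * exp (- G)) into a convolution.\<close>

lemma discontinuous_part_factor:
  fixes M :: "'a measure"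
  assumes bdlp: "background_driving_levy_process M Y \<mu>"
    and decomp: "levy_decomposition M Y Yc Yd" and nz: "nonzero_process M Yd"
  shows "\<exists>\<nu>. convolution_factor \<nu> \<mu> \<and> (\<forall>c. \<nu> \<noteq> return borel c) \<and>
    (\<exists>(P :: (real \<times> real \<times> real) measure) A C Z.
      prob_space P \<and>
      prob_space.indep_vars P (\<lambda>_. borel) (\<lambda>i::nat. [A, C, Z] ! i) {..<3} \<and>
      distr P borel Z = \<nu> \<and>
      distr P borel (\<lambda>\<omega>. A \<omega> * (Z \<omega> + C \<omega>)) = \<nu> \<and>
      (AE \<omega> in P. 0 \<le> A \<omega> \<and> A \<omega> \<le> 1) \<and>
      nontrivial_multiplier P A)"
proof -
  have Yc: "purely_continuous M Yc" and Yd: "purely_discontinuous M Yd"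
    and indep: "independent_processes M Yc Yd"
    and Y_eq: "AE \<omega> in M. \<forall>t\<ge>0. Y t \<omega> = Yc t \<omega> + Yd t \<omega>"
    using decomp unfolding levy_decomposition_def by auto
  have levy: "levy_process M Y" "levy_process M Yc" "levy_process M Yd"
    using bdlp Yc Yd
    unfolding background_driving_levy_process_def purely_continuous_def purely_discontinuous_def by auto
  then interpret prob_space M unfolding levy_process_def by auto
  have meas [measurable]: "Y t \<in> borel_measurable M" "Yc t \<in> borel_measurable M" "Yd t \<in> borel_measurable M"
    if "0 \<le> t" for t
    using levy that unfolding levy_process_def by auto
  obtain K R where "bounded_jump_measure K R"
    and split: "\<And>h. 0 \<le> h \<Longrightarrow> \<exists>g. characteristic_function g \<and>
      (\<forall>u. char (distr M borel (Yd h)) u = g u * exp (of_real h * cp_exponent K u))"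
    using purely_discontinuous_split[OF Yd nz] by blast
  then interpret bounded_jump_measure K R by simp
  have "\<exists>g. characteristic_function g \<and>
      (\<forall>u. char (distr M borel (Y h)) u = g u * exp (of_real h * cp_exponent K u))" if h: "0 \<le> h" for h
  proof -
    obtain g where g: "characteristic_function g"
      "\<And>u. char (distr M borel (Yd h)) u = g u * exp (of_real h * cp_exponent K u)"
      using split[OF h] by blast
    have "distr M borel (Y h) = distr M borel (\<lambda>\<omega>. Yc h \<omega> + Yd h \<omega>)"
      using Y_eq h meas[OF h] by (intro distr_cong_AE) (auto elim!: eventually_mono)
    then have "char (distr M borel (Y h)) u = char (distr M borel (Yc h)) u * g u * exp (of_real h * cp_exponent K u)" for u
      using char_independent_processes[OF prob_space_axioms indep h, of u] by (simp add: g(2))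
    moreover have "characteristic_function (\<lambda>u. char (distr M borel (Yc h)) u * g u)"
      using meas[OF h] by (intro characteristic_function_mult g(1) characteristic_function_char) auto
    ultimately show ?thesis by blast
  qed
  from levy_factor[OF bdlp this] obtain \<rho>
    where \<rho>: "real_distribution \<rho>" "\<And>u. char \<rho> u = char \<mu> u * exp (- G u)"
    unfolding characteristic_function_def by metis
  from characteristic_function_exp_G obtain \<nu>
    where \<nu>: "real_distribution \<nu>" "char \<nu> = (\<lambda>u. exp (G u))"
    unfolding characteristic_function_def by metis
  have "real_distribution \<mu>"
    using bdlp unfolding background_driving_levy_process_def by auto
  moreover have "char \<mu> u = char (\<nu> \<star> \<rho>) u" for u
    unfolding real_distribution_convolution(2)[OF \<nu>(1) \<rho>(1)] \<rho>(2) \<nu>(2) by (simp add: exp_minus)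
  ultimately have "\<mu> = (\<nu> \<star> \<rho>)"
    by (intro Levy_uniqueness real_distribution_convolution(1) \<nu>(1) \<rho>(1)) auto
  then have "convolution_factor \<nu> \<mu>"
    unfolding convolution_factor_def using \<nu>(1) \<rho>(1) by blast
  moreover have "\<nu> \<noteq> return borel c" for c
  proof
    assume "\<nu> = return borel c"
    then have "char \<nu> u = iexp (u * c)" for u
      by (simp add: char_def integral_return)
    then show False
      using exp_G_nondegenerate[of c] by (simp add: \<nu>(2))
  qed
  ultimately show ?thesis
    using compound_poisson_factor[OF \<nu>] by blast
qed

section \<open>Perpetuities\<close>

text \<open>The joint law of (A, B) in (i): the law of B must depend on the value of A, so one fair
  coin selects the constant and the matching draw together.\<close>

definition mix_law :: "real \<Rightarrow> real measure \<Rightarrow> real \<Rightarrow> real measure \<Rightarrow> (real \<times> real) measure" where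
  "mix_law a M b N = distr (bernoulli_mix (1 / 2) M N) borel
    (\<lambda>z. if fst z then (a, fst (snd z)) else (b, snd (snd z)))"

context
  fixes a b :: real and M N :: "real measure"
  assumes MN: "real_distribution M" "real_distribution N"
begin

interpretation prob_space "bernoulli_mix (1 / 2) M N"
  using MN by (rule prob_space_bernoulli_mix)

lemma mix_map_measurable:
  "(\<lambda>z. if fst z then (a, fst (snd z)) else (b, snd (snd z))) \<in> borel_measurable (bernoulli_mix (1 / 2) M N)"
proof -
  note [measurable_cong] = sets_bernoulli_mix[OF MN, of "1 / 2"]
  show ?thesis unfolding borel_prod[symmetric] by measurable
qed

lemma prob_space_mix_law: "prob_space (mix_law a M b N)"
  unfolding mix_law_def by (rule prob_space_distr[OF mix_map_measurable])

lemma sets_mix_law [simp]: "sets (mix_law a M b N) = sets borel"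
  unfolding mix_law_def by simp

lemma integral_mix_law:
  fixes f :: "real \<times> real \<Rightarrow> complex"
  assumes [measurable]: "f \<in> borel_measurable borel" and bound: "\<And>p. norm (f p) \<le> B"
  shows "(CLINT p|mix_law a M b N. f p) = ((CLINT x|M. f (a, x)) + (CLINT x|N. f (b, x))) / 2"
proof -
  have [measurable]: "(\<lambda>x. f (c, x)) \<in> borel_measurable borel" for c
    by (rule measurable_compose[where N = "borel \<Otimes>\<^sub>M borel"]) (auto simp: borel_prod)
  have "(CLINT p|mix_law a M b N. f p) =
      (CLINT z|bernoulli_mix (1 / 2) M N. if fst z then f (a, fst (snd z)) else f (b, snd (snd z)))"
    unfolding mix_law_def
    by (subst integral_distr[OF mix_map_measurable]) (auto intro!: Bochner_Integration.integral_cong)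
  also have "\<dots> = of_real (1 / 2) * (CLINT x|M. f (a, x)) + of_real (1 - 1 / 2) * (CLINT x|N. f (b, x))"
    by (rule integral_bernoulli_mix[OF MN, where B = B and f = "\<lambda>x. f (a, x)" and g = "\<lambda>x. f (b, x)"])
       (use bound in auto)
  finally show ?thesis by simp
qed

text \<open>Both values have positive probability, so an almost sure property of the first component
  holds at each of them.\<close>

lemma AE_mix_law_fst:
  assumes [measurable]: "Measurable.pred borel Q"
  shows "(AE p in mix_law a M b N. Q (fst p)) \<longleftrightarrow> Q a \<and> Q b"
proof -
  have meas: "Measurable.pred borel (\<lambda>p :: real \<times> real. Q (fst p))"
    unfolding borel_prod[symmetric] by measurable
  have iff: "(AE p in mix_law a M b N. Q (fst p)) \<longleftrightarrow>
      (AE z in bernoulli_mix (1 / 2) M N. if fst z then Q a else Q b)"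
    unfolding mix_law_def
    using meas by (subst AE_distr_iff[OF mix_map_measurable]) (auto intro!: AE_cong)
  show ?thesis
  proof
    \<comment> \<open>The mean of two numbers from {0, 1} is 1 only if both are 1; the values are
      complex so that \<open>integral_mix_law\<close> applies.\<close>
    define c where "c x = (if Q x then 1 else 0 :: complex)" for x
    note [measurable_cong] = sets_mix_law
    have norm_c: "norm (c x) \<le> 1" for x by (simp add: c_def)
    have [measurable]: "(\<lambda>p :: real \<times> real. c (fst p)) \<in> borel_measurable borel"
      unfolding c_def borel_prod[symmetric] by measurable
    assume "AE p in mix_law a M b N. Q (fst p)"
    then have "AE p in mix_law a M b N. c (fst p) = 1"
      by eventually_elim (simp add: c_def)
    then have "(CLINT p|mix_law a M b N. c (fst p)) = (CLINT p|mix_law a M b N. 1)"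
      by (intro integral_cong_AE) measurable
    also have "\<dots> = 1"
      using prob_space.prob_space[OF prob_space_mix_law] by simp
    also have "(CLINT p|mix_law a M b N. c (fst p)) = ((CLINT x|M. c a) + (CLINT x|N. c b)) / 2"
      using integral_mix_law[of "\<lambda>p. c (fst p)" 1] by (simp add: norm_c)
    also have "\<dots> = (c a + c b) / 2"
      using MN[THEN real_distribution.axioms(1), THEN prob_space.prob_space] by simp
    finally show "Q a \<and> Q b"
      unfolding c_def by (auto split: if_splits)
  next
    assume "Q a \<and> Q b"
    then show "AE p in mix_law a M b N. Q (fst p)"
      unfolding iff by auto
  qed
qed

end

section \<open>Affine iterations along an i.i.d. sequence\<close>

lemma affine_iteration_cong:
  assumes "\<And>i. i < n \<Longrightarrow> A i \<omega> = A' i \<omega>'" "\<And>i. i < n \<Longrightarrow> B i \<omega> = B' i \<omega>'"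
  shows "affine_iteration A B n \<omega> = affine_iteration A' B' n \<omega>'"
  using assms by (induction n) auto

locale affine_law = prob_space \<kappa> for \<kappa> :: "(real \<times> real) measure" +
  assumes sets_law [simp, measurable_cong]: "sets \<kappa> = sets borel"
begin

text \<open>The canonical model of an i.i.d. sequence with law \<open>\<kappa>\<close>; its type is
  the sample space fixed in \<open>perpetuity\<close>.\<close>

definition path_space :: "(nat \<Rightarrow> real \<times> real) measure" where
  "path_space = PiM UNIV (\<lambda>_. \<kappa>)"

sublocale paths: prob_space path_space
  unfolding path_space_def by (intro prob_space_PiM prob_space_axioms)

lemma sets_path_space [measurable_cong]: "sets path_space = sets (PiM UNIV (\<lambda>_. borel))"
  unfolding path_space_def by (intro sets_PiM_cong) auto

lemma distr_coordinate: "distr path_space borel (\<lambda>\<omega>. \<omega> n) = \<kappa>"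
proof -
  have "distr path_space borel (\<lambda>\<omega>. \<omega> n) = distr path_space \<kappa> (\<lambda>\<omega>. \<omega> n)"
    by (rule distr_cong) auto
  also have "\<dots> = \<kappa>"
    unfolding path_space_def by (rule distr_PiM_component) (auto intro: prob_space_axioms)
  finally show ?thesis .
qed

lemma indep_coordinates: "paths.indep_vars (\<lambda>_. borel) (\<lambda>n \<omega>. \<omega> n) UNIV"
proof (subst paths.indep_vars_iff_distr_eq_PiM)
  have "distr path_space (PiM UNIV (\<lambda>_. borel)) (\<lambda>\<omega>. \<lambda>i\<in>UNIV. \<omega> i) = distr path_space path_space (\<lambda>\<omega>. \<omega>)"
    by (rule distr_cong) (auto simp: sets_path_space)
  also have "\<dots> = PiM UNIV (\<lambda>i. distr path_space borel (\<lambda>\<omega>. \<omega> i))"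
    unfolding distr_coordinate distr_id by (simp add: path_space_def)
  finally show "distr path_space (PiM UNIV (\<lambda>_. borel)) (\<lambda>\<omega>. \<lambda>i\<in>UNIV. \<omega> i) =
      PiM UNIV (\<lambda>i. distr path_space borel (\<lambda>\<omega>. \<omega> i))" .
qed auto

definition iterate :: "nat \<Rightarrow> (nat \<Rightarrow> real \<times> real) \<Rightarrow> real" where
  "iterate = affine_iteration (\<lambda>n \<omega>. fst (\<omega> n)) (\<lambda>n \<omega>. snd (\<omega> n))"

lemma iterate_Suc: "iterate (Suc n) \<omega> = fst (\<omega> n) * iterate n \<omega> + snd (\<omega> n)"
  by (simp add: iterate_def)

text \<open>The index set is left free for two uses: all coordinates for the random variable itself,
  and those below n for its independence of coordinate n.\<close>

lemma iterate_measurable: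
  assumes "{..<n} \<subseteq> I"
  shows "iterate n \<in> borel_measurable (PiM I (\<lambda>_. borel))"
  using assms
proof (induction n)
  case 0
  then show ?case by (simp add: iterate_def)
next
  case (Suc n)
  have "{..<n} \<subseteq> I" using Suc.prems by auto
  then have [measurable]: "iterate n \<in> borel_measurable (PiM I (\<lambda>_. borel))" by (rule Suc.IH)
  have "(\<lambda>\<omega>. \<omega> n) \<in> measurable (PiM I (\<lambda>_. borel)) (borel \<Otimes>\<^sub>M borel :: (real \<times> real) measure)"
    unfolding borel_prod using Suc.prems by (intro measurable_component_singleton) auto
  then have [measurable]: "(\<lambda>\<omega>. fst (\<omega> n)) \<in> borel_measurable (PiM I (\<lambda>_. borel :: (real \<times> real) measure))"
    "(\<lambda>\<omega>. snd (\<omega> n)) \<in> borel_measurable (PiM I (\<lambda>_. borel :: (real \<times> real) measure))"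
    by measurable
  show ?case
    unfolding iterate_Suc[abs_def] by measurable
qed

lemma iterate_random_variable [measurable]: "iterate n \<in> borel_measurable path_space"
  using iterate_measurable[of n UNIV] by (simp cong: measurable_cong_sets[OF sets_path_space refl])

text \<open>Padded with a zero because \<open>indep_var\<close> wants both variables in the same type.\<close>

lemma indep_iterate: "paths.indep_var borel (\<lambda>\<omega>. (iterate n \<omega>, 0)) borel (\<lambda>\<omega>. \<omega> n)"
proof -
  have "paths.indep_var (PiM {..<n} (\<lambda>_. borel)) (\<lambda>\<omega>. \<lambda>i\<in>{..<n}. \<omega> i)
      (PiM {n} (\<lambda>_. borel)) (\<lambda>\<omega>. \<lambda>i\<in>{n}. \<omega> i)"
    by (rule paths.indep_var_restrict[OF indep_coordinates]) auto
  then have "paths.indep_var borel ((\<lambda>\<omega>. (iterate n \<omega>, 0)) \<circ> (\<lambda>\<omega>. \<lambda>i\<in>{..<n}. \<omega> i))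
      borel ((\<lambda>\<omega>. \<omega> n) \<circ> (\<lambda>\<omega>. \<lambda>i\<in>{n}. \<omega> i))"
  proof (rule paths.indep_var_compose)
    have "(\<lambda>\<omega>. (iterate n \<omega>, 0 :: real)) \<in> measurable (PiM {..<n} (\<lambda>_. borel)) (borel \<Otimes>\<^sub>M borel)"
      by (intro measurable_Pair measurable_const iterate_measurable) auto
    then show "(\<lambda>\<omega>. (iterate n \<omega>, 0 :: real)) \<in> borel_measurable (PiM {..<n} (\<lambda>_. borel))"
      by (simp only: borel_prod)
  qed auto
  \<comment> \<open>The iterate reads only coordinates below n, so restricting the path changes
    nothing.\<close>
  moreover have "iterate n (\<lambda>i\<in>{..<n}. \<omega> i) = iterate n \<omega>" for \<omega>
    unfolding iterate_def by (auto intro!: affine_iteration_cong)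
  ultimately show ?thesis by (simp add: comp_def)
qed

text \<open>Independence is available for the padded variable; pushing the product law forward along
  \<open>fst\<close> in the first component removes the padding.\<close>

lemma distr_iterate_coordinate:
  "distr path_space (borel \<Otimes>\<^sub>M borel) (\<lambda>\<omega>. (iterate n \<omega>, \<omega> n)) = distr path_space borel (iterate n) \<Otimes>\<^sub>M \<kappa>"
proof -
  let ?X = "\<lambda>\<omega>. (iterate n \<omega>, 0 :: real)" and ?D = "distr path_space borel (\<lambda>\<omega>. (iterate n \<omega>, 0 :: real))"
  have law: "?D \<Otimes>\<^sub>M \<kappa> = distr path_space (borel \<Otimes>\<^sub>M borel) (\<lambda>\<omega>. (?X \<omega>, \<omega> n))"
    using indep_iterate[of n] unfolding paths.indep_var_distribution_eq distr_coordinate by simp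
  have X [measurable]: "?X \<in> borel_measurable path_space" and [measurable]: "(\<lambda>\<omega>. \<omega> n) \<in> borel_measurable path_space"
    using indep_iterate[of n] paths.indep_var_rv1 paths.indep_var_rv2 by blast+
  have fst_meas [measurable]: "fst \<in> borel_measurable (borel :: (real \<times> real) measure)"
    unfolding borel_prod[symmetric] by measurable
  have "distr path_space borel (iterate n) \<Otimes>\<^sub>M \<kappa> = distr ?D borel fst \<Otimes>\<^sub>M distr \<kappa> borel (\<lambda>p. p)"
    by (subst distr_distr) (auto simp: comp_def distr_id2)
  also have "\<dots> = distr (?D \<Otimes>\<^sub>M \<kappa>) (borel \<Otimes>\<^sub>M borel) (\<lambda>(x, y). (fst x, y))"
    by (rule pair_measure_distr)
       (auto simp: distr_id2 measurable_ident_sets intro: prob_space_imp_sigma_finite prob_space_axioms)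
  also have "\<dots> = distr path_space (borel \<Otimes>\<^sub>M borel) ((\<lambda>(x, y). (fst x, y)) \<circ> (\<lambda>\<omega>. (?X \<omega>, \<omega> n)))"
    unfolding law by (rule distr_distr) measurable
  finally show ?thesis by (simp add: comp_def)
qed

text \<open>Fubini, integrating the state first: given (a, b) it enters at frequency u * a. The law
  \<open>\<nu>\<close> is arbitrary because the iterates and \<mu> itself are both inserted.\<close>

lemma char_affine_image:
  assumes "real_distribution \<nu>"
  shows "(CLINT z|\<nu> \<Otimes>\<^sub>M \<kappa>. iexp (u * (fst (snd z) * fst z + snd (snd z)))) =
    (CLINT p|\<kappa>. iexp (u * snd p) * char \<nu> (u * fst p))"
proof -
  interpret \<nu>: real_distribution \<nu> by fact
  interpret pair_prob_space \<nu> \<kappa> ..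
  have [measurable]: "fst \<in> borel_measurable \<kappa>" "snd \<in> borel_measurable \<kappa>"
    unfolding measurable_cong_sets[OF sets_law refl] borel_prod[symmetric] by measurable
  have "(CLINT z|\<nu> \<Otimes>\<^sub>M \<kappa>. iexp (u * (fst (snd z) * fst z + snd (snd z)))) =
      (CLINT p|\<kappa>. CLINT x|\<nu>. iexp (u * (fst p * x + snd p)))"
    using integral_snd[of "\<lambda>x p. iexp (u * (fst p * x + snd p))"]
    by (simp add: split_beta' integrable_const_bound[where B = 1])
  also have "\<dots> = (CLINT p|\<kappa>. CLINT x|\<nu>. iexp (u * snd p) * iexp (u * fst p * x))"
    by (intro Bochner_Integration.integral_cong refl) (simp add: exp_add[symmetric] algebra_simps)
  finally show ?thesis
    unfolding char_def by simp
qed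

lemma char_iterate_Suc:
  "char (distr path_space borel (iterate (Suc n))) u =
    (CLINT p|\<kappa>. iexp (u * snd p) * char (distr path_space borel (iterate n)) (u * fst p))"
proof -
  have [measurable]: "(\<lambda>\<omega>. \<omega> n) \<in> borel_measurable path_space" by measurable
  have [measurable]: "fst \<in> borel_measurable (borel :: (real \<times> real) measure)"
    "snd \<in> borel_measurable (borel :: (real \<times> real) measure)"
    unfolding borel_prod[symmetric] by measurable
  have "char (distr path_space borel (iterate (Suc n))) u =
      (CLINT \<omega>|path_space. iexp (u * (fst (\<omega> n) * iterate n \<omega> + snd (\<omega> n))))"
    unfolding char_def by (subst integral_distr) (auto simp: iterate_Suc)
  also have "\<dots> = (CLINT z|distr path_space (borel \<Otimes>\<^sub>M borel) (\<lambda>\<omega>. (iterate n \<omega>, \<omega> n)).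
      iexp (u * (fst (snd z) * fst z + snd (snd z))))"
  proof (subst integral_distr)
    show "(\<lambda>\<omega>. (iterate n \<omega>, \<omega> n)) \<in> measurable path_space (borel \<Otimes>\<^sub>M borel)"
      by (intro measurable_Pair) auto
    show "(\<lambda>z :: real \<times> real \<times> real. iexp (u * (fst (snd z) * fst z + snd (snd z)))) \<in> borel_measurable (borel \<Otimes>\<^sub>M borel)"
      unfolding borel_prod[symmetric] by measurable
  qed simp
  also have "\<dots> = (CLINT p|\<kappa>. iexp (u * snd p) * char (distr path_space borel (iterate n)) (u * fst p))"
    unfolding distr_iterate_coordinate by (rule char_affine_image) auto
  finally show ?thesis .
qed

text \<open>
  The iteration map contracts the frequency by the factor \<open>r\<close> in every step, so only the behaviour
  of the fixed point near frequency \<open>0\<close> matters in the end.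
\<close>

lemma perpetuity_fixed_point:
  assumes \<mu>: "real_distribution \<mu>"
    and fixed: "\<And>u. char \<mu> u = (CLINT p|\<kappa>. iexp (u * snd p) * char \<mu> (u * fst p))"
    and r: "0 \<le> r" "r < 1" and contr: "AE p in \<kappa>. \<bar>fst p\<bar> \<le> r"
  shows "perpetuity \<kappa> \<mu>"
proof -
  interpret \<mu>: real_distribution \<mu> by fact
  define \<phi> where "\<phi> n = char (distr path_space borel (iterate n))" for n
  interpret it: real_distribution "distr path_space borel (iterate n)" for n
    by (rule paths.real_distribution_distr) measurable
  have [measurable]: "fst \<in> borel_measurable \<kappa>" "snd \<in> borel_measurable \<kappa>"
    unfolding measurable_cong_sets[OF sets_law refl] borel_prod[symmetric] by measurable
  have [measurable]: "\<phi> n \<in> borel_measurable borel" for n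
    unfolding \<phi>_def by (rule it.char_measurable)
  have \<phi>_0: "\<phi> 0 u = 1" for u
    unfolding \<phi>_def char_def using paths.prob_space
    by (subst integral_distr[OF iterate_random_variable]) (auto simp: iterate_def)
  \<comment> \<open>Both sides obey the same recursion, so n steps reduce the comparison to
    frequencies of size at most |u| * r^n, where the start \<open>\<phi> 0\<close> is identically 1.
    The induction varies u because each step rescales it.\<close>
  have diff_bound: "norm (\<phi> n u - char \<mu> u) \<le> \<delta>"
    if "\<And>v. \<bar>v\<bar> \<le> \<bar>u\<bar> * r ^ n \<Longrightarrow> norm (1 - char \<mu> v) \<le> \<delta>" for n u \<delta>
    using that
  proof (induction n arbitrary: u)
    case 0
    then show ?case by (simp add: \<phi>_0)
  next
    case (Suc n)
    have int: "integrable \<kappa> (\<lambda>p. iexp (u * snd p) * \<psi> (u * fst p))"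
      if [measurable]: "\<psi> \<in> borel_measurable borel" and "\<And>v. norm (\<psi> v) \<le> 1" for \<psi>
      by (rule integrable_const_bound[where B = 1]) (use that in \<open>auto simp: norm_mult\<close>)
    have int_\<phi>: "integrable \<kappa> (\<lambda>p. iexp (u * snd p) * \<phi> n (u * fst p))"
      by (rule int) (auto simp: \<phi>_def it.cmod_char_le_1)
    have int_\<mu>: "integrable \<kappa> (\<lambda>p. iexp (u * snd p) * char \<mu> (u * fst p))"
      by (rule int) (auto simp: \<mu>.cmod_char_le_1)
    have "\<phi> (Suc n) u - char \<mu> u =
        (CLINT p|\<kappa>. iexp (u * snd p) * \<phi> n (u * fst p) - iexp (u * snd p) * char \<mu> (u * fst p))"
      unfolding fixed[of u] using int_\<phi> int_\<mu>
      by (subst Bochner_Integration.integral_diff) (auto simp: \<phi>_def char_iterate_Suc)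
    also have "norm \<dots> \<le> (LINT p|\<kappa>. \<delta>)"
    proof (rule order_trans[OF integral_norm_bound integral_mono_AE])
      show "AE p in \<kappa>. norm (iexp (u * snd p) * \<phi> n (u * fst p) - iexp (u * snd p) * char \<mu> (u * fst p)) \<le> \<delta>"
        using contr
      proof eventually_elim
        case (elim p)
        have "norm (iexp (u * snd p) * \<phi> n (u * fst p) - iexp (u * snd p) * char \<mu> (u * fst p)) =
            norm (\<phi> n (u * fst p) - char \<mu> (u * fst p))"
          unfolding right_diff_distrib[symmetric] norm_mult by simp
        also have "\<dots> \<le> \<delta>"
        proof (rule Suc.IH, rule Suc.prems)
          fix v assume "\<bar>v\<bar> \<le> \<bar>u * fst p\<bar> * r ^ n"
          also have "\<dots> \<le> (\<bar>u\<bar> * r) * r ^ n"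
            using elim r unfolding abs_mult by (intro mult_right_mono mult_left_mono) auto
          finally show "\<bar>v\<bar> \<le> \<bar>u\<bar> * r ^ Suc n" by (simp add: mult.assoc)
        qed
        finally show ?case .
      qed
    qed (use int_\<phi> int_\<mu> in auto)
    also have "\<dots> = \<delta>" using prob_space by simp
    finally show ?case .
  qed
  have "(\<lambda>n. \<phi> n u) \<longlonglongrightarrow> char \<mu> u" for u
  proof (rule tendstoI)
    fix \<epsilon> :: real assume "0 < \<epsilon>"
    then have "\<exists>d>0. \<forall>v. dist v 0 < d \<longrightarrow> dist (char \<mu> v) (char \<mu> 0) < \<epsilon> / 2"
      using \<mu>.isCont_char[of 0] unfolding continuous_at_eps_delta by (meson half_gt_zero)
    then obtain d where d: "0 < d" "\<And>v. \<bar>v\<bar> < d \<Longrightarrow> norm (1 - char \<mu> v) < \<epsilon> / 2"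
      unfolding \<mu>.char_zero by (auto simp: dist_norm norm_minus_commute)
    have "(\<lambda>n. \<bar>u\<bar> * r ^ n) \<longlonglongrightarrow> \<bar>u\<bar> * 0"
      using r by (intro tendsto_intros LIMSEQ_power_zero) auto
    then have "eventually (\<lambda>n. \<bar>u\<bar> * r ^ n < d) sequentially"
      using d(1) by (intro order_tendstoD(2)) auto
    then show "eventually (\<lambda>n. dist (\<phi> n u) (char \<mu> u) < \<epsilon>) sequentially"
    proof eventually_elim
      case (elim n)
      have "norm (\<phi> n u - char \<mu> u) \<le> \<epsilon> / 2"
        by (rule diff_bound) (use elim d(2) in \<open>force intro: less_imp_le\<close>)
      then show ?case using \<open>0 < \<epsilon>\<close> by (simp add: dist_norm)
    qed
  qed
  then have "weak_conv_m (\<lambda>n. distr path_space borel (iterate n)) \<mu>"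
    unfolding \<phi>_def by (intro levy_continuity \<mu> it.real_distribution_axioms)
  then show ?thesis
    unfolding perpetuity_def
    using indep_coordinates distr_coordinate paths.prob_space_axioms
    by (intro exI[of _ path_space] exI[of _ "\<lambda>n \<omega>. fst (\<omega> n)"] exI[of _ "\<lambda>n \<omega>. snd (\<omega> n)"])
       (auto simp: iterate_def)
qed

end

section \<open>Selfdecomposable laws as perpetuities\<close>

lemma selfdecomposable_char:
  assumes "selfdecomposable \<mu>" "0 < t"
  obtains \<rho> where "real_distribution \<rho>" "\<And>u. char \<mu> u = char \<rho> u * char \<mu> (u * exp (- t))"
proof -
  obtain \<rho> where \<mu>: "real_distribution \<mu>" and \<rho>: "real_distribution \<rho>"
    and eq: "\<mu> = (\<rho> \<star> distr \<mu> borel (\<lambda>x. exp (- t) * x))"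
    using assms unfolding selfdecomposable_def by blast
  interpret \<mu>: real_distribution \<mu> by fact
  have D: "real_distribution (distr \<mu> borel (\<lambda>x. exp (- t) * x))"
    by (rule \<mu>.real_distribution_distr) measurable
  have "char (distr \<mu> borel (\<lambda>x. exp (- t) * x)) u = char \<mu> (u * exp (- t))" for u
    unfolding char_def by (subst integral_distr) (auto simp: mult.assoc)
  then have "char \<mu> u = char \<rho> u * char \<mu> (u * exp (- t))" for u
    by (subst eq) (simp only: real_distribution_convolution(2)[OF \<rho> D])
  then show ?thesis using that \<rho> by blast
qed

text \<open>The fixed point equation is the average of the decompositions of \<mu> at times 1 and 2:
  each holds separately, hence so does their mixture.\<close>

lemma selfdecomposable_perpetuity:
  fixes \<mu> :: "real measure"
  assumes "selfdecomposable \<mu>"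
  shows "\<exists>(P :: (real \<times> real \<times> real) measure) A B Z.
    prob_space P \<and>
    independent_rvs P borel (\<lambda>\<omega>. (A \<omega>, B \<omega>)) borel Z \<and>
    distr P borel Z = \<mu> \<and>
    distr P borel (\<lambda>\<omega>. A \<omega> * Z \<omega> + B \<omega>) = \<mu> \<and>
    (AE \<omega> in P. 0 \<le> A \<omega> \<and> A \<omega> \<le> 1) \<and>
    nontrivial_multiplier P A \<and>
    perpetuity (distr P borel (\<lambda>\<omega>. (A \<omega>, B \<omega>))) \<mu>"
proof -
  obtain \<rho>1 where \<rho>1: "real_distribution \<rho>1" "\<And>u. char \<mu> u = char \<rho>1 u * char \<mu> (u * exp (- 1))"
    using selfdecomposable_char[OF assms, of 1] by auto
  obtain \<rho>2 where \<rho>2: "real_distribution \<rho>2" "\<And>u. char \<mu> u = char \<rho>2 u * char \<mu> (u * exp (- 2))"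
    using selfdecomposable_char[OF assms, of 2] by auto
  have \<mu>: "real_distribution \<mu>" using assms unfolding selfdecomposable_def by auto
  interpret \<mu>: real_distribution \<mu> by fact
  define \<kappa> where "\<kappa> = mix_law (exp (- 1)) \<rho>1 (exp (- 2)) \<rho>2"
  interpret \<kappa>: affine_law \<kappa>
    unfolding \<kappa>_def affine_law_def affine_law_axioms_def
    using prob_space_mix_law[OF \<rho>1(1) \<rho>2(1)] sets_mix_law[OF \<rho>1(1) \<rho>2(1)] by blast
  have [measurable]: "fst \<in> borel_measurable \<kappa>" "snd \<in> borel_measurable \<kappa>"
    unfolding measurable_cong_sets[OF \<kappa>.sets_law refl] borel_prod[symmetric] by measurable
  have fixed: "char \<mu> u = (CLINT p|\<kappa>. iexp (u * snd p) * char \<mu> (u * fst p))" for u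
  proof -
    have "(CLINT p|\<kappa>. iexp (u * snd p) * char \<mu> (u * fst p)) =
        ((CLINT x|\<rho>1. iexp (u * x) * char \<mu> (u * exp (- 1))) + (CLINT x|\<rho>2. iexp (u * x) * char \<mu> (u * exp (- 2)))) / 2"
      unfolding \<kappa>_def
      by (subst integral_mix_law[OF \<rho>1(1) \<rho>2(1), where B = 1])
         (auto simp: norm_mult \<mu>.cmod_char_le_1 borel_prod[symmetric])
    also have "\<dots> = (char \<rho>1 u * char \<mu> (u * exp (- 1)) + char \<rho>2 u * char \<mu> (u * exp (- 2))) / 2"
      unfolding char_def by simp
    also have "\<dots> = char \<mu> u"
      unfolding \<rho>1(2)[symmetric] \<rho>2(2)[symmetric] by simp
    finally show ?thesis ..
  qed
  have AE_\<kappa>: "(AE p in \<kappa>. Q (fst p)) \<longleftrightarrow> Q (exp (- 1)) \<and> Q (exp (- 2))"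
    if "Measurable.pred borel Q" for Q
    unfolding \<kappa>_def by (rule AE_mix_law_fst[OF \<rho>1(1) \<rho>2(1) that])
  have perp: "perpetuity \<kappa> \<mu>"
  proof (rule \<kappa>.perpetuity_fixed_point[OF \<mu> fixed])
    \<comment> \<open>The contraction rate is the larger of the two values of A.\<close>
    show "AE p in \<kappa>. \<bar>fst p\<bar> \<le> exp (- 1)"
      by (subst AE_\<kappa>) auto
  qed auto
  interpret X: pair_prob_space \<kappa> \<mu> ..
  \<comment> \<open>The product space of nested pairs is flattened to triples, the sample space
    fixed in the goal.\<close>
  define P where "P = distr (\<kappa> \<Otimes>\<^sub>M \<mu>) (borel \<Otimes>\<^sub>M (borel \<Otimes>\<^sub>M borel)) (\<lambda>z. (fst (fst z), snd (fst z), snd z))"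
  have map [measurable]: "(\<lambda>z. (fst (fst z), snd (fst z), snd z)) \<in>
      measurable (\<kappa> \<Otimes>\<^sub>M \<mu>) (borel \<Otimes>\<^sub>M (borel \<Otimes>\<^sub>M borel))"
    by measurable
  interpret P: prob_space P
    unfolding P_def by (rule X.prob_space_distr[OF map])
  have sets_P [measurable_cong]: "sets P = sets (borel \<Otimes>\<^sub>M (borel \<Otimes>\<^sub>M borel))"
    unfolding P_def by simp
  define A where "A = (fst :: real \<times> real \<times> real \<Rightarrow> real)"
  define B where "B \<omega> = fst (snd \<omega>)" for \<omega> :: "real \<times> real \<times> real"
  define Z where "Z \<omega> = snd (snd \<omega>)" for \<omega> :: "real \<times> real \<times> real"
  have [measurable]: "A \<in> borel_measurable P" "B \<in> borel_measurable P" "Z \<in> borel_measurable P"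
    unfolding A_def B_def[abs_def] Z_def[abs_def] by measurable
  have AB [measurable]: "(\<lambda>\<omega>. (A \<omega>, B \<omega>)) \<in> borel_measurable P"
    unfolding borel_prod[symmetric] by measurable
  \<comment> \<open>This product formula yields both marginal laws, by taking the whole space for
    one of the sets, and then independence.\<close>
  have joint: "P.prob ((\<lambda>\<omega>. (A \<omega>, B \<omega>)) -` S \<inter> space P \<inter> (Z -` T \<inter> space P)) = \<kappa>.prob S * \<mu>.prob T"
    if S: "S \<in> sets borel" and T: "T \<in> sets borel" for S T
  proof -
    have "(\<lambda>\<omega>. (A \<omega>, B \<omega>)) -` S \<inter> space P \<inter> (Z -` T \<inter> space P) \<in> sets P"
      using measurable_sets[OF AB S] measurable_sets[of Z P borel T] T by auto
    moreover have "(\<lambda>z. (fst (fst z), snd (fst z), snd z)) -`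
        ((\<lambda>\<omega>. (A \<omega>, B \<omega>)) -` S \<inter> space P \<inter> (Z -` T \<inter> space P)) \<inter> space (\<kappa> \<Otimes>\<^sub>M \<mu>) = S \<times> T"
      using sets_eq_imp_space_eq[OF \<kappa>.sets_law] sets_eq_imp_space_eq[OF sets_P]
      by (auto simp: A_def B_def Z_def space_pair_measure)
    ultimately have "P.prob ((\<lambda>\<omega>. (A \<omega>, B \<omega>)) -` S \<inter> space P \<inter> (Z -` T \<inter> space P)) =
        measure (\<kappa> \<Otimes>\<^sub>M \<mu>) (S \<times> T)"
      unfolding P_def by (subst measure_distr[OF map]) auto
    also have "\<dots> = \<kappa>.prob S * \<mu>.prob T"
      using S T by (simp add: measure_def \<mu>.emeasure_pair_measure_Times enn2real_mult)
    finally show ?thesis .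
  qed
  have \<mu>1: "\<mu>.prob UNIV = 1" and \<kappa>1: "\<kappa>.prob UNIV = 1"
    using \<mu>.prob_space \<kappa>.prob_space sets_eq_imp_space_eq[OF \<kappa>.sets_law] by simp_all
  have prob_AB: "P.prob ((\<lambda>\<omega>. (A \<omega>, B \<omega>)) -` S \<inter> space P) = \<kappa>.prob S" if "S \<in> sets borel" for S
    using joint[OF that, of UNIV] \<mu>1 by simp
  have prob_Z: "P.prob (Z -` T \<inter> space P) = \<mu>.prob T" if "T \<in> sets borel" for T
    using joint[of UNIV T] that \<kappa>1 by simp
  have law_AB: "distr P borel (\<lambda>\<omega>. (A \<omega>, B \<omega>)) = \<kappa>"
  proof (rule measure_eqI)
    fix S assume "S \<in> sets (distr P borel (\<lambda>\<omega>. (A \<omega>, B \<omega>)))"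
    then have "S \<in> sets borel" by simp
    then show "emeasure (distr P borel (\<lambda>\<omega>. (A \<omega>, B \<omega>))) S = emeasure \<kappa> S"
      using prob_AB by (subst emeasure_distr[OF AB]) (auto simp: P.emeasure_eq_measure \<kappa>.emeasure_eq_measure)
  qed simp
  have law_Z: "distr P borel Z = \<mu>"
  proof (rule measure_eqI)
    fix T assume "T \<in> sets (distr P borel Z)"
    then have "T \<in> sets borel" by simp
    then show "emeasure (distr P borel Z) T = emeasure \<mu> T"
      using prob_Z by (subst emeasure_distr) (auto simp: P.emeasure_eq_measure \<mu>.emeasure_eq_measure)
  qed simp
  have indep: "independent_rvs P borel (\<lambda>\<omega>. (A \<omega>, B \<omega>)) borel Z"
    unfolding independent_rvs_def P.indep_sets2_eq
  proof (intro conjI AB ballI)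
    fix a b
    assume "a \<in> {(\<lambda>\<omega>. (A \<omega>, B \<omega>)) -` S \<inter> space P |S. S \<in> sets borel}" "b \<in> {Z -` S \<inter> space P |S. S \<in> sets borel}"
    then obtain S T where "S \<in> sets borel" "T \<in> sets borel"
      "a = (\<lambda>\<omega>. (A \<omega>, B \<omega>)) -` S \<inter> space P" "b = Z -` T \<inter> space P" by auto
    then show "P.prob (a \<inter> b) = P.prob a * P.prob b"
      using joint prob_AB prob_Z by simp
  qed (use measurable_sets[OF AB] in \<open>auto intro: measurable_sets\<close>)
  have law: "distr P borel (\<lambda>\<omega>. A \<omega> * Z \<omega> + B \<omega>) = \<mu>"
  proof (rule Levy_uniqueness[OF _ \<mu>])
    show "real_distribution (distr P borel (\<lambda>\<omega>. A \<omega> * Z \<omega> + B \<omega>))"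
      by (rule P.real_distribution_distr) measurable
    interpret Y: pair_prob_space \<mu> \<kappa> ..
    show "char (distr P borel (\<lambda>\<omega>. A \<omega> * Z \<omega> + B \<omega>)) = char \<mu>"
    proof
      fix u
      have "char (distr P borel (\<lambda>\<omega>. A \<omega> * Z \<omega> + B \<omega>)) u = (CLINT \<omega>|P. iexp (u * (A \<omega> * Z \<omega> + B \<omega>)))"
        unfolding char_def by (subst integral_distr) auto
      also have "\<dots> = (CLINT z|\<kappa> \<Otimes>\<^sub>M \<mu>. iexp (u * (fst (fst z) * snd z + snd (fst z))))"
        unfolding P_def by (subst integral_distr[OF map]) (auto simp: A_def B_def Z_def)
      \<comment> \<open>\<open>char_affine_image\<close> has the state first, so the factors are
        swapped.\<close>
      also have "\<dots> = (CLINT z|\<mu> \<Otimes>\<^sub>M \<kappa>. iexp (u * (fst (snd z) * fst z + snd (snd z))))"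
        by (subst Y.integral_product_swap[symmetric]) (auto simp: split_beta')
      also have "\<dots> = char \<mu> u"
        unfolding fixed[of u] by (rule \<kappa>.char_affine_image[OF \<mu>])
      finally show "char (distr P borel (\<lambda>\<omega>. A \<omega> * Z \<omega> + B \<omega>)) u = char \<mu> u" .
    qed
  qed
  have AE_A: "(AE \<omega> in P. Q (A \<omega>)) \<longleftrightarrow> Q (exp (- 1)) \<and> Q (exp (- 2))" if [measurable]: "Measurable.pred borel Q" for Q
  proof -
    have "Measurable.pred borel (\<lambda>p :: real \<times> real. Q (fst p))"
      unfolding borel_prod[symmetric] by measurable
    then have "(AE \<omega> in P. Q (A \<omega>)) \<longleftrightarrow> (AE p in distr P borel (\<lambda>\<omega>. (A \<omega>, B \<omega>)). Q (fst p))"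
      by (subst AE_distr_iff[OF AB]) auto
    then show ?thesis unfolding law_AB AE_\<kappa>[OF that] .
  qed
  have "AE \<omega> in P. 0 \<le> A \<omega> \<and> A \<omega> \<le> 1"
    by (subst AE_A) auto
  moreover have "nontrivial_multiplier P A"
    \<comment> \<open>The two values of A are distinct and both lie strictly between 0 and
      1.\<close>
    unfolding nontrivial_multiplier_def by (subst (1 2) AE_A) auto
  ultimately show ?thesis
    using indep law_Z law perp P.prob_space_axioms
    by (intro exI[of _ P] exI[of _ A] exI[of _ B] exI[of _ Z]) (auto simp: law_AB)
qed

theorem corollary4:
  fixes \<mu> :: "real measure"
  assumes "selfdecomposable \<mu>"
  shows
    "(\<exists>(P :: (real \<times> real \<times> real) measure) A B Z.
        prob_space P \<and>
        independent_rvs P borel (\<lambda>\<omega>. (A \<omega>, B \<omega>)) borel Z \<and>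
        distr P borel Z = \<mu> \<and>
        distr P borel (\<lambda>\<omega>. A \<omega> * Z \<omega> + B \<omega>) = \<mu> \<and>
        (AE \<omega> in P. 0 \<le> A \<omega> \<and> A \<omega> \<le> 1) \<and>
        nontrivial_multiplier P A \<and>
        perpetuity (distr P borel (\<lambda>\<omega>. (A \<omega>, B \<omega>))) \<mu>)
     \<and>
     (\<forall>(M :: 'a measure) Y Yc Yd.
        background_driving_levy_process M Y \<mu> \<and>
        levy_decomposition M Y Yc Yd \<and>
        nonzero_process M Yd \<longrightarrow>
        (\<exists>\<nu>. convolution_factor \<nu> \<mu> \<and>
             (\<forall>c. \<nu> \<noteq> return borel c) \<and>
             (\<exists>(P :: (real \<times> real \<times> real) measure) A C Z.
                prob_space P \<and>
                prob_space.indep_vars P (\<lambda>_. borel) (\<lambda>i::nat. [A, C, Z] ! i) {..<3} \<and>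
                distr P borel Z = \<nu> \<and>
                distr P borel (\<lambda>\<omega>. A \<omega> * (Z \<omega> + C \<omega>)) = \<nu> \<and>
                (AE \<omega> in P. 0 \<le> A \<omega> \<and> A \<omega> \<le> 1) \<and>
                nontrivial_multiplier P A)))"
  using selfdecomposable_perpetuity[OF assms] discontinuous_part_factor by blast

end
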